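(* Let $\Omega\subset\mathbb{R}^d$ be a bounded Lipschitz domain, $d\ge2$, $k\in\mathbb{N}_+$, $m$ an integer with $0\le m\le k$, and let $X$ be a quasi-Banach space with continuous embedding $X\hookrightarrow H^m(\Omega)$ and unit ball $B_X$. Suppose that for some $\gamma>0$, $\kappa\ge0$, $M_0<\infty$ and every $f\in B_X$ there exists, for every integer $N\ge1$, an approximant $$\widetilde g_N=P_N+\sum_{r=1}^N a_r\sigma_k(\omega_r\cdot x-b_r),\qquad P_N\in\Pi_k,\quad(\omega_r,b_r)\in\mathbb{S}^{d-1}\times[b_-,b_+],$$ satisfying $$\|f-\widetilde g_N\|_{H^m(\Omega)}\lesssim N^{-\gamma}(1+\log(2+N))^\kappa,\qquad\sum_{r=1}^N|a_r|\le M_0,$$ with implicit constant independent of $f$ and $N$. Then there is a fixed $\widetilde M_0<\infty$ such that, for every integer $n\ge1$, $$E_{n,m}(B_X;\widetilde M_0)\lesssim n^{-\gamma}(1+\log(2+n))^\kappa,$$ with implicit constant independent of $n$.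
   Context: $\sigma_k(t)=(\max\{t,0\})^k$; $\Pi_k$ is the space of polynomials on $\mathbb{R}^d$ of total degree at most $k$; $\|f\|_{H^m(\Omega)}^2=\sum_{|\alpha|\le m}\|D^\alpha f\|_{L^2(\Omega)}^2$. The reals $b_-,b_+$ are fixed with $b_-<\inf_{x\in\Omega,|\omega|=1}\omega\cdot x-1$ and $b_+>\sup_{x\in\Omega,|\omega|=1}\omega\cdot x+1$. For $n\in\mathbb{N}_0$, $M\in[0,\infty]$, $$\Sigma_{n,M}=\Bigl\{\sum_{r=1}^N a_r\sigma_k(\omega_r\cdot x-b_r):\ N\in\{0,\dots,n\},\ |\omega_r|=1,\ b_r\in[b_-,b_+],\ \sum_{r=1}^N|a_r|\le M\Bigr\},$$ (the empty sum is $0$), and $E_{n,m}(B_X;M)=\sup_{\|f\|_X\le1}\inf_{g\in\Sigma_{n,M}}\|f-g\|_{H^m(\Omega)}$. *)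

theory Defs
  imports "HOL-Analysis.Analysis"
begin

section \<open>Partial derivatives, test functions and multi-indices\<close>

definition partial_deriv :: "'n::finite \<Rightarrow> (real^'n \<Rightarrow> real) \<Rightarrow> real^'n \<Rightarrow> real" where
  "partial_deriv i f x = frechet_derivative f (at x) (axis i 1)"

fun partial_derivs :: "'n::finite list \<Rightarrow> (real^'n \<Rightarrow> real) \<Rightarrow> real^'n \<Rightarrow> real" where
  "partial_derivs [] f = f"
| "partial_derivs (i # is) f = partial_deriv i (partial_derivs is f)"

text \<open>Differentiability of every iterated partial derivative makes all of them continuous, so this
  is the class of infinitely differentiable functions.\<close>

definition smooth :: "(real^'n::finite \<Rightarrow> real) \<Rightarrow> bool" where
  "smooth f \<longleftrightarrow> (\<forall>is x. partial_derivs is f differentiable (at x))"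

definition test_function :: "(real^'n::finite) set \<Rightarrow> (real^'n \<Rightarrow> real) \<Rightarrow> bool" where
  "test_function \<Omega> \<phi> \<longleftrightarrow>
     smooth \<phi> \<and> compact (closure {x. \<phi> x \<noteq> 0}) \<and> closure {x. \<phi> x \<noteq> 0} \<subseteq> \<Omega>"

definition mi_degree :: "('n::finite \<Rightarrow> nat) \<Rightarrow> nat" where
  "mi_degree \<alpha> = (\<Sum>i\<in>UNIV. \<alpha> i)"

text \<open>The index type carries no order, so the order of differentiation is an arbitrary choice;
  for smooth functions it is irrelevant.\<close>

definition mi_deriv :: "('n::finite \<Rightarrow> nat) \<Rightarrow> (real^'n \<Rightarrow> real) \<Rightarrow> real^'n \<Rightarrow> real" where
  "mi_deriv \<alpha> f = partial_derivs (SOME is. \<forall>i. count_list is i = \<alpha> i) f"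

lemma ex_list_count: "\<exists>is. \<forall>i. count_list is i = \<alpha> i"
  for \<alpha> :: "'n::finite \<Rightarrow> nat"
proof -
  have "\<exists>is. \<forall>i. count_list is i = (if i \<in> A then \<alpha> i else 0)" if "finite A" for A
    using that
  proof (induction A)
    case empty
    show ?case by (rule exI[of _ "[]"]) simp
  next
    case (insert a A)
    then obtain "is" where "is": "\<forall>i. count_list is i = (if i \<in> A then \<alpha> i else 0)" by blast
    have rep: "count_list (replicate n a) i = (if i = a then n else 0)" for n i
      by (induction n) auto
    show ?case
      using "is" insert.hyps by (intro exI[of _ "replicate (\<alpha> a) a @ is"]) (auto simp: rep)
  qed
  from this[of UNIV] show ?thesis by simp
qed


section \<open>The Sobolev space \<open>H\<^sup>m(\<Omega>)\<close>\<close>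

definition locally_integrable_on :: "(real^'n::finite \<Rightarrow> real) \<Rightarrow> (real^'n) set \<Rightarrow> bool" where
  "locally_integrable_on f \<Omega> \<longleftrightarrow> (\<forall>K. compact K \<and> K \<subseteq> \<Omega> \<longrightarrow> f absolutely_integrable_on K)"

definition is_weak_deriv ::
    "(real^'n::finite) set \<Rightarrow> ('n \<Rightarrow> nat) \<Rightarrow> (real^'n \<Rightarrow> real) \<Rightarrow> (real^'n \<Rightarrow> real) \<Rightarrow> bool" where
  "is_weak_deriv \<Omega> \<alpha> f g \<longleftrightarrow>
     locally_integrable_on f \<Omega> \<and> locally_integrable_on g \<Omega> \<and>
     (\<forall>\<phi>. test_function \<Omega> \<phi> \<longrightarrow>
        (\<integral>x. f x * mi_deriv \<alpha> \<phi> x \<partial>lebesgue_on \<Omega>) =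
        (-1) ^ mi_degree \<alpha> * (\<integral>x. g x * \<phi> x \<partial>lebesgue_on \<Omega>))"

text \<open>Elements of function spaces are represented by functions on the whole of \<open>real^'n\<close>, of which
  only the restriction to \<open>\<Omega>\<close> modulo null sets matters. In particular a weak derivative is
  unique only almost everywhere, and \<open>weak_deriv\<close> picks a representative.\<close>

definition weak_deriv ::
    "(real^'n::finite) set \<Rightarrow> ('n \<Rightarrow> nat) \<Rightarrow> (real^'n \<Rightarrow> real) \<Rightarrow> real^'n \<Rightarrow> real" where
  "weak_deriv \<Omega> \<alpha> f = (SOME g. is_weak_deriv \<Omega> \<alpha> f g)"

definition L2_space :: "(real^'n::finite) set \<Rightarrow> (real^'n \<Rightarrow> real) set" where
  "L2_space \<Omega> = {f. f \<in> borel_measurable (lebesgue_on \<Omega>) \<and>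
                     integrable (lebesgue_on \<Omega>) (\<lambda>x. (f x)\<^sup>2)}"

definition L2_norm :: "(real^'n::finite) set \<Rightarrow> (real^'n \<Rightarrow> real) \<Rightarrow> real" where
  "L2_norm \<Omega> f = sqrt (\<integral>x. (f x)\<^sup>2 \<partial>lebesgue_on \<Omega>)"

definition sobolev_space :: "(real^'n::finite) set \<Rightarrow> nat \<Rightarrow> (real^'n \<Rightarrow> real) set" where
  "sobolev_space \<Omega> m =
     {f. \<forall>\<alpha>. mi_degree \<alpha> \<le> m \<longrightarrow> (\<exists>g\<in>L2_space \<Omega>. is_weak_deriv \<Omega> \<alpha> f g)}"

text \<open>Only meaningful for members of \<open>sobolev_space \<Omega> m\<close>.\<close>

definition sobolev_norm :: "(real^'n::finite) set \<Rightarrow> nat \<Rightarrow> (real^'n \<Rightarrow> real) \<Rightarrow> real" where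
  "sobolev_norm \<Omega> m f = sqrt (\<Sum>\<alpha> | mi_degree \<alpha> \<le> m. (L2_norm \<Omega> (weak_deriv \<Omega> \<alpha> f))\<^sup>2)"


section \<open>Bounded Lipschitz domains\<close>

text \<open>Near each boundary point \<open>\<Omega>\<close> is, in coordinates with vertical direction \<open>e\<close>, the part of a
  ball strictly above the graph of a Lipschitz function \<open>\<psi>\<close> on the hyperplane orthogonal to \<open>e\<close>;
  \<open>x - (x \<bullet> e) *\<^sub>R e\<close> is the horizontal component of \<open>x\<close>.\<close>

definition bounded_lipschitz_domain :: "(real^'n::finite) set \<Rightarrow> bool" where
  "bounded_lipschitz_domain \<Omega> \<longleftrightarrow>
     open \<Omega> \<and> connected \<Omega> \<and> \<Omega> \<noteq> {} \<and> bounded \<Omega> \<and>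
     (\<forall>p\<in>frontier \<Omega>. \<exists>r>0. \<exists>e L \<psi>. norm e = 1 \<and> L-lipschitz_on {y. y \<bullet> e = 0} \<psi> \<and>
        \<Omega> \<inter> ball p r = {x \<in> ball p r. x \<bullet> e > \<psi> (x - (x \<bullet> e) *\<^sub>R e)})"


section \<open>Quasi-Banach spaces and continuous embeddings into \<open>H\<^sup>m(\<Omega>)\<close>\<close>

definition quasi_norm :: "('x::real_vector \<Rightarrow> real) \<Rightarrow> bool" where
  "quasi_norm q \<longleftrightarrow>
     (\<forall>x. 0 \<le> q x) \<and> (\<forall>x. q x = 0 \<longleftrightarrow> x = 0) \<and>
     (\<forall>c x. q (c *\<^sub>R x) = \<bar>c\<bar> * q x) \<and>
     (\<exists>K\<ge>1. \<forall>x y. q (x + y) \<le> K * (q x + q y))"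

definition quasi_banach :: "('x::real_vector \<Rightarrow> real) \<Rightarrow> bool" where
  "quasi_banach q \<longleftrightarrow> quasi_norm q \<and>
     (\<forall>u::nat \<Rightarrow> 'x. (\<forall>\<epsilon>>0. \<exists>N. \<forall>i\<ge>N. \<forall>j\<ge>N. q (u i - u j) < \<epsilon>) \<longrightarrow>
        (\<exists>l. (\<lambda>i. q (u i - l)) \<longlonglongrightarrow> 0))"

text \<open>\<open>\<iota> x\<close> is a representative of the element of \<open>H\<^sup>m(\<Omega>)\<close> to which \<open>x\<close> is mapped, whence linearity
  and injectivity are modulo equality almost everywhere on \<open>\<Omega>\<close>.\<close>

definition continuous_embedding ::
    "('x::real_vector \<Rightarrow> real) \<Rightarrow> (real^'n::finite) set \<Rightarrow> nat \<Rightarrow> ('x \<Rightarrow> real^'n \<Rightarrow> real) \<Rightarrow> bool" where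
  "continuous_embedding q \<Omega> m \<iota> \<longleftrightarrow>
     (\<forall>x. \<iota> x \<in> sobolev_space \<Omega> m) \<and>
     (\<forall>x y. AE z in lebesgue_on \<Omega>. \<iota> (x + y) z = \<iota> x z + \<iota> y z) \<and>
     (\<forall>c x. AE z in lebesgue_on \<Omega>. \<iota> (c *\<^sub>R x) z = c * \<iota> x z) \<and>
     (\<forall>x. (AE z in lebesgue_on \<Omega>. \<iota> x z = 0) \<longrightarrow> x = 0) \<and>
     (\<exists>C. \<forall>x. sobolev_norm \<Omega> m (\<iota> x) \<le> C * q x)"


section \<open>Polynomials, ridge functions and the approximation error\<close>

definition polys :: "nat \<Rightarrow> (real^'n::finite \<Rightarrow> real) set" where
  "polys k = {P. \<exists>c. \<forall>x. P x = (\<Sum>\<alpha> | mi_degree \<alpha> \<le> k. c \<alpha> * (\<Prod>i\<in>UNIV. (x $ i) ^ \<alpha> i))}"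

definition relu_pow :: "nat \<Rightarrow> real \<Rightarrow> real" where
  "relu_pow k t = (max t 0) ^ k"

definition ridge_sum ::
    "nat \<Rightarrow> nat \<Rightarrow> (nat \<Rightarrow> real) \<Rightarrow> (nat \<Rightarrow> real^'n::finite) \<Rightarrow> (nat \<Rightarrow> real) \<Rightarrow> real^'n \<Rightarrow> real" where
  "ridge_sum k N a \<omega> b x = (\<Sum>r=1..N. a r * relu_pow k (\<omega> r \<bullet> x - b r))"

definition ridge_class ::
    "nat \<Rightarrow> real \<Rightarrow> real \<Rightarrow> nat \<Rightarrow> ennreal \<Rightarrow> (real^'n::finite \<Rightarrow> real) set" where
  "ridge_class k b\<^sub>m b\<^sub>p n M =
     {ridge_sum k N a \<omega> b | N a \<omega> b.
        N \<le> n \<and> (\<forall>r\<in>{1..N}. norm (\<omega> r) = 1 \<and> b r \<in> {b\<^sub>m..b\<^sub>p}) \<and> ennreal (\<Sum>r=1..N. \<bar>a r\<bar>) \<le> M}"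

definition approx_error ::
    "(real^'n::finite) set \<Rightarrow> nat \<Rightarrow> real \<Rightarrow> real \<Rightarrow> nat \<Rightarrow> nat \<Rightarrow> (real^'n \<Rightarrow> real) set \<Rightarrow> ennreal \<Rightarrow> ennreal"
  where
  "approx_error \<Omega> k b\<^sub>m b\<^sub>p n m B M =
     (SUP f\<in>B. INF g\<in>ridge_class k b\<^sub>m b\<^sub>p n M. ennreal (sobolev_norm \<Omega> m (\<lambda>x. f x - g x)))"

end

theory Submission
  imports Defs "HOL-Computational_Algebra.Polynomial"
begin

text \<open>The polynomial parts \<open>P\<^sub>N\<close> are bounded in \<open>L\<^sup>2(\<Omega>)\<close>, because the approximated function and the error
  are bounded in \<open>H\<^sup>m(\<Omega>)\<close>, and the ridge part is uniformly bounded. By polarization, \<open>\<Pi>\<^sub>k\<close> is spanned by finitely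
  many powers \<open>(\<omega> \<bullet> x - b)\<^sup>k\<close> with \<open>b\<close> below all values of \<open>\<omega> \<bullet> x\<close>, which on \<open>\<Omega>\<close> are ridge functions.
  Since \<open>\<Pi>\<^sub>k\<close> has finite dimension, \<open>P\<^sub>N\<close> is a combination of these fixed \<open>K\<close> ridge functions with bounded
  coefficients; so \<open>N + K\<close> ridge functions suffice, and the shift by \<open>K\<close> only changes the constant.

  On \<open>\<Omega>\<close> the resulting ridge sum equals the given approximant, so no weak derivative of a ridge
  function is ever computed. The only relation between the Sobolev norm and the functions that is
  used is that the weak derivative of order zero equals the function almost everywhere, that is,
  the fundamental lemma of the calculus of variations.\<close>

section \<open>Smooth bump functions on boxes\<close>

text \<open>For \<open>p = 1\<close> this is the classical function exp(-1/t) extended by zero. The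
  polynomial factor in 1/t is there because the family is then closed under differentiation.\<close>

definition flat :: "real poly \<Rightarrow> real \<Rightarrow> real" where
  "flat p t = (if t > 0 then poly p (1 / t) * exp (- (1 / t)) else 0)"

lemma poly_times_exp_neg_tendsto_0: "((\<lambda>s. poly p s * exp (- s)) \<longlongrightarrow> 0) at_top" for p :: "real poly"
proof -
  have "((\<lambda>s. \<Sum>i\<le>degree p. coeff p i * (s ^ i / exp s)) \<longlongrightarrow> (\<Sum>i\<le>degree p. coeff p i * 0)) at_top"
    by (intro tendsto_intros tendsto_power_div_exp_0)
  then show ?thesis
    by (simp add: poly_altdef sum_distrib_right exp_minus divide_inverse mult.assoc)
qed

text \<open>Since \<open>flat p 0 = 0\<close>, this is the difference quotient at the gluing point.
  From the right, s = 1/t turns it into a polynomial in s times exp(-s); from the left it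
  vanishes.\<close>

lemma flat_div_tendsto_0: "((\<lambda>t. flat p t / t) \<longlongrightarrow> 0) (at 0)"
proof -
  have "((\<lambda>t. flat p t / t) \<longlongrightarrow> 0) (at_right 0)"
  proof (rule Lim_transform_eventually)
    \<comment> \<open>The factor \<open>monom 1 1\<close> absorbs the division by t.\<close>
    show "((\<lambda>t. poly (monom 1 1 * p) (inverse t) * exp (- inverse t)) \<longlongrightarrow> 0) (at_right (0::real))"
      by (rule filterlim_compose[OF poly_times_exp_neg_tendsto_0 filterlim_inverse_at_top_right])
    show "\<forall>\<^sub>F t in at_right 0. poly (monom 1 1 * p) (inverse t) * exp (- inverse t) = flat p t / t"
      by (auto simp: eventually_at_filter flat_def poly_monom divide_inverse)
  qed
  moreover have "((\<lambda>t. flat p t / t) \<longlongrightarrow> 0) (at_left 0)"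
    by (rule Lim_transform_eventually[OF tendsto_const]) (auto simp: eventually_at_filter flat_def)
  ultimately show ?thesis
    by (simp add: filterlim_at_split)
qed

text \<open>With s = 1/t and ds/dt = -s^2, the chain rule turns p(s) exp(-s) into s^2 (p(s) - p'(s))
  exp(-s).\<close>

definition flat_deriv :: "real poly \<Rightarrow> real poly" where
  "flat_deriv p = monom 1 2 * (p - pderiv p)"

lemma DERIV_flat: "(flat p has_real_derivative flat (flat_deriv p) t) (at t)"
proof -
  consider "t > 0" | "t < 0" | "t = 0" by linarith
  then show ?thesis
  proof cases
    case 1
    have "((\<lambda>t. poly p (1 / t) * exp (- (1 / t))) has_real_derivative flat (flat_deriv p) t) (at t)"
      using 1 by (auto intro!: derivative_eq_intros
          simp: flat_def flat_deriv_def poly_monom field_simps power2_eq_square)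
    then show ?thesis
      by (rule has_field_derivative_transform_within_open[where S = "{0<..}"]) (use 1 in \<open>auto simp: flat_def\<close>)
  next
    case 2
    have "((\<lambda>_. 0) has_real_derivative flat (flat_deriv p) t) (at t)"
      using 2 by (auto simp: flat_def)
    then show ?thesis
      by (rule has_field_derivative_transform_within_open[where S = "{..<0}"]) (use 2 in \<open>auto simp: flat_def\<close>)
  next
    case 3
    then show ?thesis
      using flat_div_tendsto_0[of p] by (simp add: has_field_derivative_iff flat_def)
  qed
qed

text \<open>A class of functions closed under partial derivatives, hence consisting of smooth functions.\<close>

inductive flat_algebra :: "(real^'n::finite \<Rightarrow> real) \<Rightarrow> bool" where
  const: "flat_algebra (\<lambda>_. c)"
| flat: "flat_algebra (\<lambda>x. flat p (c * x $ i + d))"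
| add: "flat_algebra F \<Longrightarrow> flat_algebra G \<Longrightarrow> flat_algebra (\<lambda>x. F x + G x)"
| mult: "flat_algebra F \<Longrightarrow> flat_algebra G \<Longrightarrow> flat_algebra (\<lambda>x. F x * G x)"

text \<open>The induction carries the whole Frechet derivative, since \<open>partial_deriv\<close>
  evaluates \<open>frechet_derivative\<close> on axis vectors. The generators are handled by the
  chain rule with \<open>DERIV_flat\<close>, the closure operations by the sum and product
  rules.\<close>

lemma flat_algebra_has_derivative:
  assumes "flat_algebra F"
  shows "\<exists>F'. (\<forall>x. (F has_derivative F' x) (at x)) \<and> (\<forall>j. flat_algebra (\<lambda>x. F' x (axis j 1)))"
  using assms
proof induction
  case (const c)
  show ?case
    by (rule exI[of _ "\<lambda>_ _. 0"]) (auto intro: flat_algebra.const)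
next
  case (flat p c i d)
  have "((\<lambda>x. flat p (c * x $ i + d)) has_derivative
      (\<lambda>h. flat (flat_deriv p) (c * x $ i + d) * (c * h $ i))) (at x)" for x :: "real^'a"
  proof -
    have "((\<lambda>x. c * x $ i + d) has_derivative (\<lambda>h. c * h $ i)) (at x)"
      using bounded_linear_imp_has_derivative[OF bounded_linear_vec_nth]
      by (intro has_derivative_add_const has_derivative_mult_right)
    from has_derivative_compose[OF this DERIV_flat[unfolded has_field_derivative_def]] show ?thesis .
  qed
  moreover have "flat_algebra (\<lambda>x. flat (flat_deriv p) (c * x $ i + d) * (c * axis j 1 $ i))" for j
    by (intro flat_algebra.mult flat_algebra.flat flat_algebra.const)
  ultimately show ?case
    by (intro exI[of _ "\<lambda>x h. flat (flat_deriv p) (c * x $ i + d) * (c * h $ i)"]) simp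
next
  case (add F G)
  then obtain F' G' where "\<And>x. (F has_derivative F' x) (at x)" "\<And>j. flat_algebra (\<lambda>x. F' x (axis j 1))"
    "\<And>x. (G has_derivative G' x) (at x)" "\<And>j. flat_algebra (\<lambda>x. G' x (axis j 1))" by blast
  then show ?case
    by (intro exI[of _ "\<lambda>x h. F' x h + G' x h"]) (auto intro: has_derivative_add flat_algebra.add)
next
  case (mult F G)
  then obtain F' G' where "\<And>x. (F has_derivative F' x) (at x)" "\<And>j. flat_algebra (\<lambda>x. F' x (axis j 1))"
    "\<And>x. (G has_derivative G' x) (at x)" "\<And>j. flat_algebra (\<lambda>x. G' x (axis j 1))" by blast
  with mult.hyps show ?case
    by (intro exI[of _ "\<lambda>x h. F x * G' x h + F' x h * G x"])
      (auto intro!: has_derivative_mult flat_algebra.add flat_algebra.mult)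
qed

text \<open>Uniqueness of the Frechet derivative keeps each partial derivative inside the class;
  induction on the list of directions does the same for iterated ones, and all members are
  differentiable.\<close>

lemma flat_algebra_smooth:
  assumes "flat_algebra F"
  shows "smooth F"
proof -
  have "flat_algebra (partial_deriv j G)" if G: "flat_algebra G" for j G
  proof -
    obtain G' where G': "\<And>x. (G has_derivative G' x) (at x)" "\<And>j. flat_algebra (\<lambda>x. G' x (axis j 1))"
      using flat_algebra_has_derivative[OF G] by blast
    then have "partial_deriv j G = (\<lambda>x. G' x (axis j 1))"
      unfolding partial_deriv_def using frechet_derivative_at[OF G'(1)] by metis
    with G' show ?thesis by simp
  qed
  then have "flat_algebra (partial_derivs is F)" for "is"
    using assms by (induction "is") auto
  then show ?thesis
    unfolding smooth_def differentiable_def using flat_algebra_has_derivative by blast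
qed

lemma flat_algebra_prod:
  assumes "finite I" "\<And>i. i \<in> I \<Longrightarrow> flat_algebra (F i)"
  shows "flat_algebra (\<lambda>x. \<Prod>i\<in>I. F i x)"
  using assms by (induction I) (auto intro: flat_algebra.const flat_algebra.mult)

text \<open>Each factor pair is positive exactly on an open interval. Scaling the arguments by
  \<open>Suc N\<close>, which is positive even for \<open>N = 0\<close>, pushes exp(-1/t) towards 1
  as \<open>N\<close> grows, so the bumps approximate the indicator of the box.\<close>

definition box_bump :: "nat \<Rightarrow> real^'n::finite \<Rightarrow> real^'n \<Rightarrow> real^'n \<Rightarrow> real" where
  "box_bump N a b x = (\<Prod>i\<in>UNIV. flat 1 (real (Suc N) * (x $ i - a $ i)) * flat 1 (real (Suc N) * (b $ i - x $ i)))"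

lemma smooth_box_bump: "smooth (box_bump N a b)"
proof -
  have "flat_algebra (\<lambda>x. \<Prod>i\<in>UNIV. flat 1 (real (Suc N) * x $ i + real (Suc N) * - a $ i) *
      flat 1 (- real (Suc N) * x $ i + real (Suc N) * b $ i))"
    by (intro flat_algebra_prod flat_algebra.mult flat_algebra.flat) auto
  moreover have "(\<lambda>x. \<Prod>i\<in>UNIV. flat 1 (real (Suc N) * x $ i + real (Suc N) * - a $ i) *
      flat 1 (- real (Suc N) * x $ i + real (Suc N) * b $ i)) = box_bump N a b"
    by (auto simp: fun_eq_iff box_bump_def right_diff_distrib algebra_simps simp del: of_nat_Suc intro!: prod.cong)
  ultimately show ?thesis
    by (simp add: flat_algebra_smooth)
qed

lemma flat_1_bounds: "0 \<le> flat 1 t" "flat 1 t \<le> 1"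
  by (auto simp: flat_def)

lemma box_bump_bounds: "0 \<le> box_bump N a b x" "box_bump N a b x \<le> 1"
  unfolding box_bump_def
  by (auto intro!: prod_nonneg prod_le_1 mult_nonneg_nonneg mult_le_one simp: flat_1_bounds)

lemma box_bump_eq_0:
  assumes "x \<notin> box a b"
  shows "box_bump N a b x = 0"
proof -
  obtain i where "x $ i \<le> a $ i \<or> b $ i \<le> x $ i"
    using assms by (auto simp: mem_box_cart not_less)
  then have "flat 1 (real (Suc N) * (x $ i - a $ i)) * flat 1 (real (Suc N) * (b $ i - x $ i)) = 0"
    by (auto simp: flat_def zero_less_mult_iff)
  then show ?thesis
    unfolding box_bump_def by (meson UNIV_I finite prod_zero)
qed

lemma box_bump_tendsto: "(\<lambda>N. box_bump N a b x) \<longlonglongrightarrow> indicator (box a b) x"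
proof (cases "x \<in> box a b")
  case True
  have lim: "(\<lambda>N. flat 1 (real (Suc N) * t)) \<longlonglongrightarrow> 1" if "t > 0" for t
  proof -
    have "(\<lambda>N. exp (- (1 / t * inverse (real (Suc N))))) \<longlonglongrightarrow> exp (- (1 / t * 0))"
      by (intro tendsto_intros LIMSEQ_inverse_real_of_nat)
    then show ?thesis
      using that by (simp add: flat_def field_simps add_pos_nonneg)
  qed
  have "(\<lambda>N. box_bump N a b x) \<longlonglongrightarrow> (\<Prod>i\<in>(UNIV::'a set). 1 * 1)"
    unfolding box_bump_def using True by (intro tendsto_intros lim) (auto simp: mem_box_cart)
  then show ?thesis
    using True by simp
qed (simp add: box_bump_eq_0)

lemma test_function_box_bump:
  assumes "cbox a b \<subseteq> \<Omega>"
  shows "test_function \<Omega> (box_bump N a b)"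
proof -
  have "{x. box_bump N a b x \<noteq> 0} \<subseteq> cbox a b"
    using box_bump_eq_0[of _ a b N] box_subset_cbox[of a b] by blast
  then have "closure {x. box_bump N a b x \<noteq> 0} \<subseteq> cbox a b"
    by (rule closure_minimal) (rule closed_cbox)
  then show ?thesis
    using assms smooth_box_bump
    by (auto simp: test_function_def compact_eq_bounded_closed intro: bounded_subset[OF bounded_cbox])
qed

lemma continuous_on_box_bump: "continuous_on UNIV (box_bump N a b)"
proof -
  have "box_bump N a b differentiable (at x)" for x
    using smooth_box_bump[of N a b, unfolded smooth_def, rule_format, of "[]" x] by simp
  then show ?thesis
    by (simp add: continuous_on_eq_continuous_within differentiable_imp_continuous_within)
qed

section \<open>Weak derivatives of order zero and the Sobolev norm\<close>

text \<open>Open boxes form an intersection-stable generator of the Borel sets, and the sets over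
  which \<open>h\<close> has integral zero are closed under countable disjoint unions and, by
  \<open>tot\<close>, under complements. Hence all Borel integrals vanish, and \<open>h\<close> has
  the same density integrals as 0.\<close>

lemma AE_lebesgue_eq_0_if_box_integrals_0:
  fixes h :: "real^'n::finite \<Rightarrow> real"
  assumes h: "integrable lebesgue h"
    and tot: "integral\<^sup>L lebesgue h = 0"
    and box: "\<And>a b. (\<integral>x. indicator (box a b) x * h x \<partial>lebesgue) = 0"
  shows "AE x in lebesgue. h x = 0"
proof (rule density_unique_real[OF h, of "\<lambda>_. 0", simplified])
  have int: "integrable lebesgue (\<lambda>x. indicator A x * h x)" if "A \<in> sets lebesgue" for A
    using integrable_mult_indicator[OF that h] by simp
  have borel: "(\<integral>x. indicator A x * h x \<partial>lebesgue) = 0" if "A \<in> sets borel" for A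
  proof -
    have "Int_stable (range (\<lambda>(a, b). box a b :: (real^'n) set))"
      by (auto simp: Int_stable_def box_Int_box)
    moreover have "range (\<lambda>(a, b). box a b :: (real^'n) set) \<subseteq> Pow UNIV" by auto
    moreover have "A \<in> sigma_sets UNIV (range (\<lambda>(a, b). box a b :: (real^'n) set))"
      using that by (simp add: borel_eq_box)
    ultimately show ?thesis
    proof (induction rule: sigma_sets_induct_disjoint)
      case (basic A)
      then show ?case using box by auto
    next
      case empty
      show ?case by simp
    next
      case (compl A)
      then have A: "A \<in> sets lebesgue"
        by (simp add: borel_eq_box)
      have "(\<integral>x. indicator (UNIV - A) x * h x \<partial>lebesgue) = (\<integral>x. h x - indicator A x * h x \<partial>lebesgue)"
        by (intro Bochner_Integration.integral_cong) (auto simp: indicator_def)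
      then show ?case
        using compl h int[OF A] by (simp add: tot)
    next
      case (union F)
      then have F: "F i \<in> sets lebesgue" for i
        using subsetD[OF union.hyps(2), of "F i"] by (simp add: borel_eq_box)
      have "set_integrable lebesgue (\<Union>i. F i) h"
        unfolding set_integrable_def using int[of "\<Union>i. F i"] F by auto
      then have "(LINT x:(\<Union>i. F i)|lebesgue. h x) = (\<Sum>i. (LINT x:F i|lebesgue. h x))"
        using F union.hyps(1) by (intro lebesgue_integral_countable_add) (auto simp: disjoint_family_on_def)
      moreover have "(LINT x:F i|lebesgue. h x) = 0" for i
        using union.IH[of i] by (simp add: set_lebesgue_integral_def)
      ultimately show ?case
        by (simp add: set_lebesgue_integral_def)
    qed
  qed
  fix A :: "(real^'n) set" assume "A \<in> sets lebesgue"
  \<comment> \<open>A Lebesgue set is a Borel set up to a subset of a Borel null set, which does not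
    affect the integral.\<close>
  then obtain S N N' where A: "A = S \<union> N" "N \<subseteq> N'" "N' \<in> null_sets lborel" "S \<in> sets lborel"
    by (auto elim: sets_completionE)
  have "(LINT x:A|lebesgue. h x) = (LINT x:S|lebesgue. h x)"
  proof (rule set_integral_null_delta[OF h])
    show "(A - S) \<union> (S - A) \<in> null_sets lebesgue"
      by (rule null_sets_completion_subset[of _ N']) (use A in \<open>auto intro: null_sets_completionI\<close>)
  qed (use A \<open>A \<in> sets lebesgue\<close> in auto)
  then show "(LINT x:A|lebesgue. h x) = 0"
    using borel A by (simp add: set_lebesgue_integral_def)
qed

text \<open>Testing with bumps on boxes inside \<open>cbox c d\<close> and letting them converge to
  indicators shows that the difference integrates to zero over all such boxes. Working on one
  compact box turns local integrability into integrability on the whole space.\<close>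

lemma AE_eq_on_cbox_if_test_integrals_eq:
  fixes g\<^sub>1 g\<^sub>2 :: "real^'n::finite \<Rightarrow> real"
  assumes \<Omega>: "open \<Omega>" "cbox c d \<subseteq> \<Omega>"
    and g: "locally_integrable_on g\<^sub>1 \<Omega>" "locally_integrable_on g\<^sub>2 \<Omega>"
    and eq: "\<And>\<phi>. test_function \<Omega> \<phi> \<Longrightarrow>
      (\<integral>x. g\<^sub>1 x * \<phi> x \<partial>lebesgue_on \<Omega>) = (\<integral>x. g\<^sub>2 x * \<phi> x \<partial>lebesgue_on \<Omega>)"
  shows "AE x in lebesgue. x \<in> cbox c d \<longrightarrow> g\<^sub>1 x = g\<^sub>2 x"
proof -
  define h where "h x = indicator (cbox c d) x * (g\<^sub>1 x - g\<^sub>2 x)" for x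
  have int: "integrable lebesgue (\<lambda>x. indicator (cbox c d) x * g x)" if "locally_integrable_on g \<Omega>" for g
    using that \<Omega>(2) by (auto simp: locally_integrable_on_def set_integrable_def)
  have h: "integrable lebesgue h"
    using Bochner_Integration.integrable_diff[OF int int, OF g] by (simp add: h_def[abs_def] right_diff_distrib)
  have bump: "integrable lebesgue (\<lambda>x. f x * box_bump N a b x)" if "integrable lebesgue f" for f N a b
  proof (rule Bochner_Integration.integrable_bound[OF that])
    have "box_bump N a b \<in> borel_measurable lebesgue"
      using borel_measurable_continuous_onI[OF continuous_on_box_bump] by (intro measurable_completion) simp
    then show "(\<lambda>x. f x * box_bump N a b x) \<in> borel_measurable lebesgue"
      using that by (intro borel_measurable_times) auto
    show "AE x in lebesgue. norm (f x * box_bump N a b x) \<le> norm (f x)"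
      using box_bump_bounds[of N a b] by (auto simp: abs_mult intro!: mult_left_le)
  qed
  have h_bump: "(\<integral>x. h x * box_bump N a b x \<partial>lebesgue) = 0" if ab: "cbox a b \<subseteq> cbox c d" for N a b
  proof -
    have restrict: "(\<integral>x. g x * box_bump N a b x \<partial>lebesgue_on \<Omega>)
        = (\<integral>x. indicator (cbox c d) x * g x * box_bump N a b x \<partial>lebesgue)" for g
    proof -
      have "\<Omega> \<in> sets lebesgue" using \<Omega>(1) by (simp add: borel_open)
      moreover have "indicator \<Omega> x *\<^sub>R (g x * box_bump N a b x) = indicator (cbox c d) x * g x * box_bump N a b x" for x
        using ab \<Omega>(2) box_bump_eq_0[of x a b N] box_subset_cbox[of a b]
        by (cases "x \<in> box a b") (auto simp: indicator_def)
      then have "(\<lambda>x. indicator \<Omega> x *\<^sub>R (g x * box_bump N a b x)) =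
          (\<lambda>x. indicator (cbox c d) x * g x * box_bump N a b x)" by blast
      ultimately show ?thesis
        by (subst integral_restrict_space) (auto simp only: space_completion space_lborel space_borel Int_UNIV_right)
    qed
    have "test_function \<Omega> (box_bump N a b)"
      using ab \<Omega>(2) by (intro test_function_box_bump) auto
    from eq[OF this] have "(\<integral>x. indicator (cbox c d) x * g\<^sub>1 x * box_bump N a b x \<partial>lebesgue)
        - (\<integral>x. indicator (cbox c d) x * g\<^sub>2 x * box_bump N a b x \<partial>lebesgue) = 0"
      by (simp add: restrict)
    also have "(\<integral>x. indicator (cbox c d) x * g\<^sub>1 x * box_bump N a b x \<partial>lebesgue)
        - (\<integral>x. indicator (cbox c d) x * g\<^sub>2 x * box_bump N a b x \<partial>lebesgue)
        = (\<integral>x. h x * box_bump N a b x \<partial>lebesgue)"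
      by (subst Bochner_Integration.integral_diff[OF bump bump, OF int int, OF g, symmetric])
        (simp add: h_def algebra_simps)
    finally show ?thesis .
  qed
  have sub: "(\<integral>x. indicator (box a b) x * h x \<partial>lebesgue) = 0" if ab: "cbox a b \<subseteq> cbox c d" for a b
  proof -
    \<comment> \<open>Dominated convergence with majorant |\<open>h\<close>|, as the bumps take
      values between 0 and 1.\<close>
    have "(\<lambda>N. \<integral>x. h x * box_bump N a b x \<partial>lebesgue) \<longlonglongrightarrow> (\<integral>x. h x * indicator (box a b) x \<partial>lebesgue)"
    proof (rule integral_dominated_convergence[where w = "\<lambda>x. norm (h x)"])
      show "(\<lambda>x. h x * indicator (box a b) x) \<in> borel_measurable lebesgue"
        using integrable_mult_indicator[OF _ h, of "box a b"] by (simp add: mult.commute borel_measurable_integrable)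
      show "(\<lambda>x. h x * box_bump N a b x) \<in> borel_measurable lebesgue" for N
        using bump[OF h] by auto
      show "AE x in lebesgue. (\<lambda>N. h x * box_bump N a b x) \<longlonglongrightarrow> h x * indicator (box a b) x"
        by (intro AE_I2 tendsto_intros box_bump_tendsto)
      show "AE x in lebesgue. norm (h x * box_bump N a b x) \<le> norm (h x)" for N
        using box_bump_bounds[of N a b] by (auto simp: abs_mult intro!: mult_left_le)
    qed (use h in auto)
    then have "(\<lambda>N. 0 :: real) \<longlonglongrightarrow> (\<integral>x. h x * indicator (box a b) x \<partial>lebesgue)"
      by (simp add: h_bump[OF ab])
    then show ?thesis
      using LIMSEQ_unique[OF tendsto_const, of 0] by (simp add: mult.commute[of "indicator _ _"])
  qed
  have "AE x in lebesgue. indicator (box c d) x * h x = 0"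
  proof (rule AE_lebesgue_eq_0_if_box_integrals_0)
    show "integrable lebesgue (\<lambda>x. indicator (box c d) x * h x)"
      using integrable_mult_indicator[OF _ h, of "box c d"] by simp
    show "(\<integral>x. indicator (box c d) x * h x \<partial>lebesgue) = 0"
      by (rule sub) simp
    fix a b :: "real^'n"
    obtain a' b' where ab': "box a b \<inter> box c d = box a' b'"
      by (auto simp: box_Int_box)
    have "(\<integral>x. indicator (box a' b') x * h x \<partial>lebesgue) = 0"
    \<comment> \<open>Only a nonempty open box has \<open>cbox a' b'\<close> as its closure; an
      empty one may come with a closed box outside \<open>cbox c d\<close>.\<close>
    proof (cases "box a' b' = {}")
      case False
      then have "cbox a' b' \<subseteq> cbox c d"
        using ab' closure_mono[of "box a' b'" "box c d"] closure_box[of a' b'] closure_minimal[OF box_subset_cbox closed_cbox, of c d]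
        by auto
      then show ?thesis by (rule sub)
    qed simp
    also have "(\<lambda>x. indicator (box a' b') x * h x) = (\<lambda>x. indicator (box a b) x * (indicator (box c d) x * h x))"
      by (simp add: ab'[symmetric] indicator_inter_arith mult.assoc)
    finally show "(\<integral>x. indicator (box a b) x * (indicator (box c d) x * h x) \<partial>lebesgue) = 0" .
  qed
  moreover have "AE x in lebesgue. x \<notin> cbox c d - box c d"
    using negligible_frontier_interval by (intro AE_not_in) (simp add: negligible_iff_null_sets)
  ultimately show ?thesis
    by eventually_elim (auto simp: h_def indicator_def split: if_splits)
qed

text \<open>The fundamental lemma of the calculus of variations: an open set is a countable union of
  closed boxes, and countably many exceptional null sets can be merged.\<close>

lemma AE_eq_if_test_integrals_eq:
  fixes g\<^sub>1 g\<^sub>2 :: "real^'n::finite \<Rightarrow> real"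
  assumes \<Omega>: "open \<Omega>"
    and g: "locally_integrable_on g\<^sub>1 \<Omega>" "locally_integrable_on g\<^sub>2 \<Omega>"
    and eq: "\<And>\<phi>. test_function \<Omega> \<phi> \<Longrightarrow>
      (\<integral>x. g\<^sub>1 x * \<phi> x \<partial>lebesgue_on \<Omega>) = (\<integral>x. g\<^sub>2 x * \<phi> x \<partial>lebesgue_on \<Omega>)"
  shows "AE x in lebesgue_on \<Omega>. g\<^sub>1 x = g\<^sub>2 x"
proof -
  obtain \<D> where \<D>: "countable \<D>" "\<D> \<subseteq> Pow \<Omega>" "\<And>X. X \<in> \<D> \<Longrightarrow> \<exists>a b. X = cbox a b" "\<Union>\<D> = \<Omega>"
    using open_countable_Union_open_cbox[OF \<Omega>] by metis
  have "AE x in lebesgue. \<forall>X\<in>\<D>. x \<in> X \<longrightarrow> g\<^sub>1 x = g\<^sub>2 x"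
    unfolding AE_ball_countable[OF \<D>(1)]
  proof
    fix X assume X: "X \<in> \<D>"
    with \<D>(3) obtain a b where ab: "X = cbox a b" by blast
    show "AE x in lebesgue. x \<in> X \<longrightarrow> g\<^sub>1 x = g\<^sub>2 x"
      unfolding ab using X \<D>(2) ab by (intro AE_eq_on_cbox_if_test_integrals_eq[OF \<Omega> _ g eq]) auto
  qed
  moreover have "\<Omega> \<in> sets lebesgue" using \<Omega> by (simp add: borel_open)
  ultimately show ?thesis
    using \<D>(4) by (auto simp: AE_restrict_space_iff)
qed

lemma mi_degree_0: "mi_degree (\<lambda>_. 0) = 0"
  by (simp add: mi_degree_def)

text \<open>Here the arbitrary choice in \<open>mi_deriv\<close> is forced: the empty list is the
  only one with all counts zero.\<close>

lemma mi_deriv_0: "mi_deriv (\<lambda>_. 0) f = f" for f :: "real^'n::finite \<Rightarrow> real"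
proof -
  have "(SOME is :: 'n list. \<forall>i. count_list is i = 0) = []"
  proof (rule some_equality)
    fix "is" :: "'n list" assume "\<forall>i. count_list is i = 0"
    then show "is = []"
      by (cases "is") (auto split: if_splits dest: spec)
  qed simp
  then show ?thesis
    by (simp add: mi_deriv_def)
qed

lemma is_weak_deriv_0_imp_AE:
  assumes "open \<Omega>" "is_weak_deriv \<Omega> (\<lambda>_. 0) f g"
  shows "AE x in lebesgue_on \<Omega>. f x = g x"
  using assms by (intro AE_eq_if_test_integrals_eq) (auto simp: is_weak_deriv_def mi_degree_0 mi_deriv_0)

text \<open>The function is its own weak derivative of order zero, so the choice in
  \<open>weak_deriv\<close> has a witness; the fundamental lemma then identifies the chosen
  representative.\<close>

lemma weak_deriv_0_AE:
  assumes "open \<Omega>" "locally_integrable_on f \<Omega>"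
  shows "AE x in lebesgue_on \<Omega>. f x = weak_deriv \<Omega> (\<lambda>_. 0) f x"
proof -
  have "is_weak_deriv \<Omega> (\<lambda>_. 0) f f"
    using assms by (simp add: is_weak_deriv_def mi_degree_0 mi_deriv_0)
  then have "is_weak_deriv \<Omega> (\<lambda>_. 0) f (weak_deriv \<Omega> (\<lambda>_. 0) f)"
    unfolding weak_deriv_def by (rule someI[of "is_weak_deriv \<Omega> (\<lambda>_. 0) f"])
  with assms(1) show ?thesis
    by (rule is_weak_deriv_0_imp_AE)
qed

text \<open>Extension by zero moves the claim to the whole space, where Lebesgue measurability is
  stable under almost everywhere equality. This supplies the measurability of the representative
  picked by \<open>weak_deriv\<close>.\<close>

lemma borel_measurable_lebesgue_on_AE:
  fixes f g :: "'a::euclidean_space \<Rightarrow> 'b::euclidean_space"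
  assumes S: "S \<in> sets lebesgue" and f: "f \<in> borel_measurable (lebesgue_on S)"
    and ae: "AE x in lebesgue_on S. f x = g x"
  shows "g \<in> borel_measurable (lebesgue_on S)"
proof (rule borel_measurable_if_D, rule borel_measurable_AE)
  show "(\<lambda>x. if x \<in> S then f x else 0) \<in> borel_measurable lebesgue"
    using f S by (rule borel_measurable_if_I)
  show "AE x in lebesgue. (if x \<in> S then f x else 0) = (if x \<in> S then g x else 0)"
    using ae S by (auto simp: AE_restrict_space_iff)
qed

lemma finite_mi_degree_le: "finite {\<alpha> :: 'n::finite \<Rightarrow> nat. mi_degree \<alpha> \<le> m}"
proof (rule finite_subset)
  show "{\<alpha> :: 'n \<Rightarrow> nat. mi_degree \<alpha> \<le> m} \<subseteq> Pi\<^sub>E UNIV (\<lambda>_. {..m})"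
  proof safe
    fix \<alpha> :: "'n \<Rightarrow> nat" and i
    assume "mi_degree \<alpha> \<le> m"
    moreover have "\<alpha> i \<le> (\<Sum>i\<in>UNIV. \<alpha> i)" by (rule member_le_sum) auto
    ultimately show "\<alpha> i \<le> m" by (simp add: mi_degree_def)
  qed auto
qed (simp add: finite_PiE)

section \<open>Control of L2 norms by Sobolev norms\<close>

lemma sobolev_norm_nonneg: "0 \<le> sobolev_norm \<Omega> m f"
  by (simp add: sobolev_norm_def sum_nonneg)

text \<open>The summand of order zero is bounded by the full sum of nonnegative terms, and its weak
  derivative agrees almost everywhere with \<open>f\<close>, hence with the L2 representative
  \<open>g\<close>.\<close>

lemma L2_le_sobolev_norm:
  assumes \<Omega>: "open \<Omega>" and f: "locally_integrable_on f \<Omega>"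
    and g: "g \<in> L2_space \<Omega>" and ae: "AE x in lebesgue_on \<Omega>. f x = g x"
  shows "(\<integral>x. (g x)\<^sup>2 \<partial>lebesgue_on \<Omega>) \<le> (sobolev_norm \<Omega> m f)\<^sup>2"
proof -
  let ?D = "weak_deriv \<Omega> (\<lambda>_. 0) f"
  have ae': "AE x in lebesgue_on \<Omega>. g x = ?D x"
    using ae weak_deriv_0_AE[OF \<Omega> f] by eventually_elim (rule trans[OF sym])
  have "?D \<in> borel_measurable (lebesgue_on \<Omega>)"
    by (rule borel_measurable_lebesgue_on_AE[OF _ _ ae']) (use \<Omega> g in \<open>auto simp: L2_space_def borel_open\<close>)
  then have "(\<integral>x. (g x)\<^sup>2 \<partial>lebesgue_on \<Omega>) = (\<integral>x. (?D x)\<^sup>2 \<partial>lebesgue_on \<Omega>)"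
  proof (intro integral_cong_AE borel_measurable_power)
    show "AE x in lebesgue_on \<Omega>. (g x)\<^sup>2 = (?D x)\<^sup>2"
      using ae' by eventually_elim (rule arg_cong)
  qed (use g in \<open>simp_all add: L2_space_def\<close>)
  also have "\<dots> = (L2_norm \<Omega> ?D)\<^sup>2"
    by (simp add: L2_norm_def)
  also have "\<dots> \<le> (\<Sum>\<alpha> | mi_degree \<alpha> \<le> m. (L2_norm \<Omega> (weak_deriv \<Omega> \<alpha> f))\<^sup>2)"
    by (rule member_le_sum[of _ _ "\<lambda>\<alpha>. (L2_norm \<Omega> (weak_deriv \<Omega> \<alpha> f))\<^sup>2"])
      (auto simp: mi_degree_0 finite_mi_degree_le)
  also have "\<dots> = (sobolev_norm \<Omega> m f)\<^sup>2"
    by (simp add: sobolev_norm_def sum_nonneg)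
  finally show ?thesis .
qed

lemma absolutely_integrable_on_bounded_if_continuous:
  fixes h :: "real^'n::finite \<Rightarrow> real"
  assumes h: "continuous_on UNIV h" and S: "bounded S" "S \<in> sets lebesgue"
  shows "h absolutely_integrable_on S"
proof -
  obtain a b where "S \<subseteq> cbox a b"
    using bounded_subset_cbox_symmetric[OF S(1)] by metis
  moreover have "h absolutely_integrable_on cbox a b"
    using h by (intro absolutely_integrable_continuous) (auto intro: continuous_on_subset)
  ultimately show ?thesis
    using S(2) by (auto intro: set_integrable_subset)
qed

lemma L2_space_continuous:
  fixes h :: "real^'n::finite \<Rightarrow> real"
  assumes h: "continuous_on UNIV h" and \<Omega>: "open \<Omega>" "bounded \<Omega>"
  shows "h \<in> L2_space \<Omega>"
proof -
  have S: "\<Omega> \<in> sets lebesgue" using \<Omega> by (simp add: borel_open)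
  have "h absolutely_integrable_on \<Omega>" "(\<lambda>x. (h x)\<^sup>2) absolutely_integrable_on \<Omega>"
    using h \<Omega>(2) S by (auto intro!: absolutely_integrable_on_bounded_if_continuous continuous_intros)
  then show ?thesis
    using S by (auto simp: L2_space_def dest: absolutely_integrable_imp_integrable)
qed

lemma L2_space_diff:
  assumes "f \<in> L2_space \<Omega>" "g \<in> L2_space \<Omega>"
  shows "(\<lambda>x. f x - g x) \<in> L2_space \<Omega>"
proof -
  have f: "f \<in> borel_measurable (lebesgue_on \<Omega>)" "integrable (lebesgue_on \<Omega>) (\<lambda>x. (f x)\<^sup>2)"
    and g: "g \<in> borel_measurable (lebesgue_on \<Omega>)" "integrable (lebesgue_on \<Omega>) (\<lambda>x. (g x)\<^sup>2)"
    using assms by (simp_all add: L2_space_def)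
  have m: "(\<lambda>x. f x - g x) \<in> borel_measurable (lebesgue_on \<Omega>)"
    by (rule borel_measurable_diff[OF f(1) g(1)])
  have "integrable (lebesgue_on \<Omega>) (\<lambda>x. (f x - g x)\<^sup>2)"
  proof (rule Bochner_Integration.integrable_bound)
    show "integrable (lebesgue_on \<Omega>) (\<lambda>x. 2 * ((f x)\<^sup>2 + (g x)\<^sup>2))"
      by (intro Bochner_Integration.integrable_mult_right Bochner_Integration.integrable_add f g)
    show "(\<lambda>x. (f x - g x)\<^sup>2) \<in> borel_measurable (lebesgue_on \<Omega>)"
      by (rule borel_measurable_power[OF m])
    have "(a - b)\<^sup>2 \<le> 2 * (a\<^sup>2 + b\<^sup>2)" for a b :: real
      using zero_le_power2[of "a + b"] by (simp add: power2_eq_square algebra_simps)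
    then show "AE x in lebesgue_on \<Omega>. norm ((f x - g x)\<^sup>2) \<le> norm (2 * ((f x)\<^sup>2 + (g x)\<^sup>2))"
      by (intro AE_I2) simp
  qed
  with m show ?thesis
    by (simp add: L2_space_def)
qed

text \<open>Writing \<open>h\<close> as \<open>f\<close> minus the error bounds an approximant in L2
  by the Sobolev norms of the target and of the error. An L2 representative \<open>g\<close> of
  \<open>f\<close> is used for the integrals.\<close>

lemma L2_le_sobolev_norms:
  fixes h :: "real^'n::finite \<Rightarrow> real"
  assumes \<Omega>: "open \<Omega>" "bounded \<Omega>" and h: "continuous_on UNIV h" and f: "f \<in> sobolev_space \<Omega> m"
  shows "(\<integral>x. (h x)\<^sup>2 \<partial>lebesgue_on \<Omega>)
    \<le> 2 * ((sobolev_norm \<Omega> m f)\<^sup>2 + (sobolev_norm \<Omega> m (\<lambda>x. f x - h x))\<^sup>2)"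
proof -
  from f have "mi_degree (\<lambda>_::'n. 0 :: nat) \<le> m \<Longrightarrow> \<exists>g\<in>L2_space \<Omega>. is_weak_deriv \<Omega> (\<lambda>_. 0) f g"
    unfolding sobolev_space_def by blast
  then obtain g where g: "g \<in> L2_space \<Omega>" and wd: "is_weak_deriv \<Omega> (\<lambda>_. 0) f g"
    by (auto simp: mi_degree_0)
  have ae: "AE x in lebesgue_on \<Omega>. f x = g x"
    using \<Omega>(1) wd by (rule is_weak_deriv_0_imp_AE)
  have f_loc: "locally_integrable_on f \<Omega>"
    using wd by (simp add: is_weak_deriv_def)
  have h_L2: "h \<in> L2_space \<Omega>"
    using h \<Omega> by (rule L2_space_continuous)
  have gh: "(\<lambda>x. g x - h x) \<in> L2_space \<Omega>"
    using g h_L2 by (rule L2_space_diff)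
  have "locally_integrable_on (\<lambda>x. f x - h x) \<Omega>"
    unfolding locally_integrable_on_def
  proof (intro allI impI set_integral_diff(1))
    fix K assume K: "compact K \<and> K \<subseteq> \<Omega>"
    then show "f absolutely_integrable_on K"
      using f_loc by (simp add: locally_integrable_on_def)
    show "h absolutely_integrable_on K"
      using K h by (intro absolutely_integrable_on_bounded_if_continuous)
        (simp_all add: compact_imp_bounded lmeasurable_compact fmeasurableD)
  qed
  then have 1: "(\<integral>x. (g x - h x)\<^sup>2 \<partial>lebesgue_on \<Omega>) \<le> (sobolev_norm \<Omega> m (\<lambda>x. f x - h x))\<^sup>2"
    using ae by (intro L2_le_sobolev_norm[OF \<Omega>(1) _ gh]) auto
  have 2: "(\<integral>x. (g x)\<^sup>2 \<partial>lebesgue_on \<Omega>) \<le> (sobolev_norm \<Omega> m f)\<^sup>2"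
    by (rule L2_le_sobolev_norm[OF \<Omega>(1) f_loc g ae])
  have "(\<integral>x. (h x)\<^sup>2 \<partial>lebesgue_on \<Omega>) \<le> (\<integral>x. 2 * ((g x)\<^sup>2 + (g x - h x)\<^sup>2) \<partial>lebesgue_on \<Omega>)"
  proof (rule integral_mono)
    show "(h x)\<^sup>2 \<le> 2 * ((g x)\<^sup>2 + (g x - h x)\<^sup>2)" for x
      using zero_le_power2[of "2 * g x - h x"] by (simp add: power2_eq_square algebra_simps)
  qed (use g h_L2 gh in \<open>simp_all add: L2_space_def\<close>)
  also have "\<dots> = 2 * ((\<integral>x. (g x)\<^sup>2 \<partial>lebesgue_on \<Omega>) + (\<integral>x. (g x - h x)\<^sup>2 \<partial>lebesgue_on \<Omega>))"
    using g gh by (simp add: L2_space_def)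
  also have "\<dots> \<le> 2 * ((sobolev_norm \<Omega> m f)\<^sup>2 + (sobolev_norm \<Omega> m (\<lambda>x. f x - h x))\<^sup>2)"
    using add_mono[OF 2 1] by simp
  finally show ?thesis .
qed

text \<open>Although \<open>weak_deriv\<close> is an arbitrary choice, the predicate it chooses from depends on a function
  only through its values on \<open>\<Omega>\<close>.\<close>

lemma sobolev_norm_cong:
  assumes "\<Omega> \<in> sets lebesgue" "\<And>x. x \<in> \<Omega> \<Longrightarrow> f x = g x"
  shows "sobolev_norm \<Omega> m f = sobolev_norm \<Omega> m g"
proof -
  have "is_weak_deriv \<Omega> \<alpha> f h \<longleftrightarrow> is_weak_deriv \<Omega> \<alpha> g h" for \<alpha> h
  proof -
    have "f absolutely_integrable_on K \<longleftrightarrow> g absolutely_integrable_on K" if "K \<subseteq> \<Omega>" for K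
      using that assms(2) by (intro set_integrable_cong) auto
    moreover have "(\<integral>x. f x * \<phi> x \<partial>lebesgue_on \<Omega>) = (\<integral>x. g x * \<phi> x \<partial>lebesgue_on \<Omega>)" for \<phi>
      using assms(2) by (intro Bochner_Integration.integral_cong) auto
    ultimately show ?thesis
      unfolding is_weak_deriv_def locally_integrable_on_def by auto
  qed
  then show ?thesis
    by (simp add: sobolev_norm_def weak_deriv_def)
qed

section \<open>Polynomials as sums of ridge powers\<close>

lemma sum_Pow_insert:
  assumes "finite I" "a \<notin> I"
  shows "(\<Sum>S\<in>Pow (insert a I). g S) = (\<Sum>S\<in>Pow I. g S + g (insert a S))"
proof -
  have "inj_on (insert a) (Pow I)"
    using assms(2) by (auto simp: inj_on_def dest: insert_ident[THEN iffD1, rotated 2])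
  moreover have "Pow I \<inter> insert a ` Pow I = {}"
    using assms(2) by auto
  ultimately show ?thesis
    using assms(1) by (simp add: Pow_insert sum.union_disjoint sum.reindex sum.distrib)
qed

text \<open>The left side is the mixed finite difference of t^j at \<open>y\<close> with increments
  \<open>u i\<close>. Each difference lowers the degree by one, so \<open>card I\<close> of them
  annihilate smaller powers and turn the power of degree \<open>card I\<close> into a
  constant.\<close>

lemma finite_difference_power:
  fixes u :: "'i \<Rightarrow> real"
  assumes "finite I" "j \<le> card I"
  shows "(\<Sum>S\<in>Pow I. (-1) ^ card (I - S) * (y + sum u S) ^ j) =
    (if j = card I then fact j * prod u I else 0)"
  using assms
proof (induction I arbitrary: y j rule: finite_induct)
  case (insert a I)
  \<comment> \<open>Pairing \<open>S\<close> with \<open>insert a S\<close> forms the first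
    difference in direction \<open>u a\<close>: the two signs are opposite, so the term of degree
    \<open>j\<close> cancels and only degrees below \<open>j\<close> remain.\<close>
  have step: "(-1) ^ card (insert a I - S) * (y + sum u S) ^ j +
      (-1) ^ card (insert a I - insert a S) * (y + sum u (insert a S)) ^ j =
      (\<Sum>i<j. real (j choose i) * u a ^ (j - i) * ((-1) ^ card (I - S) * (y + sum u S) ^ i))"
    if "S \<in> Pow I" for S
  proof -
    have S: "a \<notin> S" "finite S" "insert a I - S = insert a (I - S)" "insert a I - insert a S = I - S"
      using that insert.hyps finite_subset by auto
    have "(y + sum u S + u a) ^ j = (\<Sum>i\<le>j. real (j choose i) * (y + sum u S) ^ i * u a ^ (j - i))"
      by (rule binomial_ring)
    also have "\<dots> = (\<Sum>i<j. real (j choose i) * (y + sum u S) ^ i * u a ^ (j - i)) + (y + sum u S) ^ j"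
      by (simp add: lessThan_Suc_atMost[symmetric])
    finally show ?thesis
      using S insert.hyps by (simp add: sum_distrib_left algebra_simps)
  qed
  have "(\<Sum>S\<in>Pow (insert a I). (-1) ^ card (insert a I - S) * (y + sum u S) ^ j) =
      (\<Sum>S\<in>Pow I. \<Sum>i<j. real (j choose i) * u a ^ (j - i) * ((-1) ^ card (I - S) * (y + sum u S) ^ i))"
    unfolding sum_Pow_insert[OF insert.hyps] by (rule sum.cong[OF refl step])
  also have "\<dots> = (\<Sum>i<j. real (j choose i) * u a ^ (j - i) *
      (\<Sum>S\<in>Pow I. (-1) ^ card (I - S) * (y + sum u S) ^ i))"
    by (subst sum.swap) (simp add: sum_distrib_left)
  also have "\<dots> = (\<Sum>i<j. real (j choose i) * u a ^ (j - i) *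
      (if i = card I then fact i * prod u I else 0))"
    using insert.prems insert.hyps by (intro sum.cong refl arg_cong2[of _ _ _ _ "(*)"] insert.IH) auto
  also have "\<dots> = (if card I < j then real (j choose card I) * u a ^ (j - card I) * (fact (card I) * prod u I) else 0)"
    by (simp add: if_distrib[of "\<lambda>t. _ * t"] sum.delta cong: if_cong)
  \<comment> \<open>Together with \<open>j \<le> card (insert a I)\<close>, the condition
    \<open>card I < j\<close> forces \<open>j = Suc (card I)\<close>; the binomial coefficient is
    then \<open>j\<close>, which completes the factorial.\<close>
  also have "\<dots> = (if j = card (insert a I) then fact j * prod u (insert a I) else 0)"
    using insert.prems insert.hyps by (auto simp: le_Suc_eq)
  finally show ?case .
qed simp

lemma prod_list_eq_prod_power_count:
  fixes f :: "'a::finite \<Rightarrow> 'b::comm_monoid_mult"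
  shows "prod_list (map f xs) = (\<Prod>i\<in>UNIV. f i ^ count_list xs i)"
proof (induction xs)
  case (Cons a xs)
  have "(\<Prod>i\<in>UNIV. f i ^ count_list (a # xs) i) = (\<Prod>i\<in>UNIV. (if i = a then f i else 1) * f i ^ count_list xs i)"
    by (rule prod.cong) auto
  with Cons show ?case
    by (simp add: prod.distrib prod.delta)
qed simp

text \<open>The linear factors of the monomial are listed with multiplicity. The remaining ones, up
  to \<open>k\<close>, are padded with the constant affine function 1, so that every degree at most
  \<open>k\<close> is treated as degree \<open>k\<close>.\<close>

lemma monomial_eq_prod_affine:
  fixes \<alpha> :: "'n::finite \<Rightarrow> nat"
  assumes "mi_degree \<alpha> \<le> k"
  shows "\<exists>v e. \<forall>x :: real^'n. (\<Prod>i\<in>UNIV. x $ i ^ \<alpha> i) = (\<Prod>j<k. v j \<bullet> x + e j)"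
proof -
  obtain "is" where "is": "\<And>i. count_list is i = \<alpha> i"
    using ex_list_count by metis
  have len: "length is = mi_degree \<alpha>"
    using sum_count_set[of "is" UNIV] by (simp add: "is" mi_degree_def)
  define v where "v j = (if j < length is then axis (is ! j) 1 else 0 :: real^'n)" for j
  define e where "e j = (if j < length is then 0 else 1 :: real)" for j
  have "(\<Prod>i\<in>UNIV. x $ i ^ \<alpha> i) = (\<Prod>j<k. v j \<bullet> x + e j)" for x :: "real^'n"
  proof -
    have "(\<Prod>i\<in>UNIV. x $ i ^ \<alpha> i) = prod_list (map (($) x) is)"
      by (simp add: prod_list_eq_prod_power_count "is")
    also have "\<dots> = (\<Prod>j<length is. x $ (is ! j))"
      by (simp add: prod.list_conv_set_nth atLeast0LessThan)
    also have "\<dots> = (\<Prod>j<k. if j < length is then x $ (is ! j) else 1)"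
      by (rule prod.mono_neutral_cong_left) (use assms len in auto)
    also have "\<dots> = (\<Prod>j<k. v j \<bullet> x + e j)"
      by (rule prod.cong) (auto simp: v_def e_def inner_axis inner_commute)
    finally show ?thesis .
  qed
  then show ?thesis by blast
qed

text \<open>A monomial is a product of \<open>k\<close> affine functions. Polarize it around a base point in the interior of
  the admissible parameter set: for small increments all affine functions that occur stay admissible
  after normalization.\<close>

lemma monomial_eq_ridge_powers:
  fixes \<alpha> :: "'n::finite \<Rightarrow> nat" and l l' :: real
  assumes \<alpha>: "mi_degree \<alpha> \<le> k" and l: "l < l'"
  shows "\<exists>T c. finite T \<and> T \<subseteq> sphere 0 1 \<times> {l..l'} \<and>
    (\<forall>x :: real^'n. (\<Prod>i\<in>UNIV. x $ i ^ \<alpha> i) = (\<Sum>t\<in>T. c t * (fst t \<bullet> x - snd t) ^ k))"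
proof -
  obtain v :: "nat \<Rightarrow> real^'n" and e :: "nat \<Rightarrow> real"
    where ve: "\<And>x :: real^'n. (\<Prod>i\<in>UNIV. x $ i ^ \<alpha> i) = (\<Prod>j<k. v j \<bullet> x + e j)"
    using monomial_eq_prod_affine[OF \<alpha>] by blast
  \<comment> \<open>Any unit vector serves as base direction; \<open>undefined\<close> merely names
    some coordinate.\<close>
  define \<omega>\<^sub>0 :: "real^'n" where "\<omega>\<^sub>0 = axis undefined 1"
  define b\<^sub>0 where "b\<^sub>0 = (l + l') / 2"
  have b\<^sub>0: "l < b\<^sub>0" "b\<^sub>0 < l'" using l by (auto simp: b\<^sub>0_def)
  have \<omega>\<^sub>0: "norm \<omega>\<^sub>0 = 1" by (simp add: \<omega>\<^sub>0_def)
  define w where "w \<epsilon> S = \<omega>\<^sub>0 + \<epsilon> *\<^sub>R sum v S" for \<epsilon> S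
  define d where "d \<epsilon> S = b\<^sub>0 - \<epsilon> * sum e S" for \<epsilon> S
  have "\<forall>\<^sub>F \<epsilon> in at_right 0. \<forall>S\<in>Pow {..<k}. norm (w \<epsilon> S) > 0 \<and> d \<epsilon> S / norm (w \<epsilon> S) > l \<and> d \<epsilon> S / norm (w \<epsilon> S) < l'"
  proof (intro eventually_ball_finite ballI eventually_conj)
    fix S
    have w: "((\<lambda>\<epsilon>. norm (w \<epsilon> S)) \<longlongrightarrow> norm (\<omega>\<^sub>0 + 0 *\<^sub>R sum v S)) (at_right 0)"
      unfolding w_def by (intro tendsto_intros)
    then show "\<forall>\<^sub>F \<epsilon> in at_right 0. norm (w \<epsilon> S) > 0"
      by (rule order_tendstoD) (simp add: \<omega>\<^sub>0)
    have "((\<lambda>\<epsilon>. d \<epsilon> S / norm (w \<epsilon> S)) \<longlongrightarrow> (b\<^sub>0 - 0 * sum e S) / norm (\<omega>\<^sub>0 + 0 *\<^sub>R sum v S)) (at_right 0)"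
      unfolding d_def by (intro tendsto_intros w) (simp add: \<omega>\<^sub>0)
    then have "((\<lambda>\<epsilon>. d \<epsilon> S / norm (w \<epsilon> S)) \<longlongrightarrow> b\<^sub>0) (at_right 0)"
      by (simp add: \<omega>\<^sub>0)
    then show "\<forall>\<^sub>F \<epsilon> in at_right 0. d \<epsilon> S / norm (w \<epsilon> S) > l" "\<forall>\<^sub>F \<epsilon> in at_right 0. d \<epsilon> S / norm (w \<epsilon> S) < l'"
      using b\<^sub>0 by (auto intro: order_tendstoD)
  qed simp
  then have "\<forall>\<^sub>F \<epsilon> in at_right 0. \<epsilon> > 0 \<and> (\<forall>S\<in>Pow {..<k}. norm (w \<epsilon> S) > 0 \<and> d \<epsilon> S / norm (w \<epsilon> S) > l \<and> d \<epsilon> S / norm (w \<epsilon> S) < l')"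
    by (intro eventually_conj eventually_at_right_less)
  then obtain \<epsilon> where \<epsilon>: "\<epsilon> > 0"
    and wd: "\<And>S. S \<in> Pow {..<k} \<Longrightarrow> norm (w \<epsilon> S) > 0 \<and> d \<epsilon> S / norm (w \<epsilon> S) > l \<and> d \<epsilon> S / norm (w \<epsilon> S) < l'"
    using eventually_happens'[OF trivial_limit_at_right_real] by blast
  define \<tau> where "\<tau> S = (sgn (w \<epsilon> S), d \<epsilon> S / norm (w \<epsilon> S))" for S
  \<comment> \<open>The sign and the division by \<open>fact k * \<epsilon> ^ k\<close> come from
    solving the finite difference identity for the product; the power of the norm compensates for
    normalizing the direction.\<close>
  define a where "a S = (-1) ^ card ({..<k} - S) * norm (w \<epsilon> S) ^ k / (fact k * \<epsilon> ^ k)" for S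
  \<comment> \<open>Different \<open>S\<close> may normalize to the same parameter pair, so
    coefficients are collected over the fibres of \<open>\<tau>\<close>.\<close>
  define c where "c t = (\<Sum>S | S \<in> Pow {..<k} \<and> \<tau> S = t. a S)" for t
  have "(\<Prod>i\<in>UNIV. x $ i ^ \<alpha> i) = (\<Sum>t\<in>\<tau> ` Pow {..<k}. c t * (fst t \<bullet> x - snd t) ^ k)" for x
  proof -
    let ?u = "\<lambda>j. \<epsilon> * (v j \<bullet> x + e j)"
    have "fact k * \<epsilon> ^ k * (\<Prod>j<k. v j \<bullet> x + e j) = fact k * prod ?u {..<k}"
      by (simp add: prod.distrib)
    \<comment> \<open>\<open>finite_difference_power\<close> with \<open>j = k\<close>, base point
      \<open>\<omega>\<^sub>0 \<bullet> x - b\<^sub>0\<close> and increments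
      \<open>?u\<close>.\<close>
    also have "\<dots> = (\<Sum>S\<in>Pow {..<k}. (-1) ^ card ({..<k} - S) * (\<omega>\<^sub>0 \<bullet> x - b\<^sub>0 + sum ?u S) ^ k)"
      by (simp add: finite_difference_power)
    also have "\<dots> = (\<Sum>S\<in>Pow {..<k}. fact k * \<epsilon> ^ k * (a S * (fst (\<tau> S) \<bullet> x - snd (\<tau> S)) ^ k))"
    proof (rule sum.cong[OF refl])
      fix S assume "S \<in> Pow {..<k}"
      with wd have pos: "norm (w \<epsilon> S) > 0" by blast
      have "\<omega>\<^sub>0 \<bullet> x - b\<^sub>0 + sum ?u S = w \<epsilon> S \<bullet> x - d \<epsilon> S"
        by (simp add: w_def d_def inner_add_left inner_sum_left sum.distrib sum_distrib_left distrib_left)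
      also have "\<dots> = norm (w \<epsilon> S) * (fst (\<tau> S) \<bullet> x - snd (\<tau> S))"
        using pos by (simp add: \<tau>_def sgn_div_norm right_diff_distrib)
      finally show "(-1) ^ card ({..<k} - S) * (\<omega>\<^sub>0 \<bullet> x - b\<^sub>0 + sum ?u S) ^ k =
          fact k * \<epsilon> ^ k * (a S * (fst (\<tau> S) \<bullet> x - snd (\<tau> S)) ^ k)"
        using \<epsilon> by (simp add: a_def power_mult_distrib)
    qed
    also have "\<dots> = fact k * \<epsilon> ^ k * (\<Sum>S\<in>Pow {..<k}. a S * (fst (\<tau> S) \<bullet> x - snd (\<tau> S)) ^ k)"
      by (simp add: sum_distrib_left)
    finally have "(\<Prod>j<k. v j \<bullet> x + e j) = (\<Sum>S\<in>Pow {..<k}. a S * (fst (\<tau> S) \<bullet> x - snd (\<tau> S)) ^ k)"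
      using \<epsilon> by simp
    also have "\<dots> = (\<Sum>t\<in>\<tau> ` Pow {..<k}. \<Sum>S | S \<in> Pow {..<k} \<and> \<tau> S = t. a S * (fst (\<tau> S) \<bullet> x - snd (\<tau> S)) ^ k)"
      by (rule sum.image_gen) simp
    also have "\<dots> = (\<Sum>t\<in>\<tau> ` Pow {..<k}. c t * (fst t \<bullet> x - snd t) ^ k)"
      unfolding c_def sum_distrib_right by (intro sum.cong) auto
    finally show ?thesis by (simp only: ve)
  qed
  moreover have "\<tau> ` Pow {..<k} \<subseteq> sphere 0 1 \<times> {l..l'}"
  proof (rule image_subsetI)
    fix S assume "S \<in> Pow {..<k}"
    from wd[OF this] show "\<tau> S \<in> sphere 0 1 \<times> {l..l'}"
      by (simp add: \<tau>_def norm_sgn)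
  qed
  moreover have "finite (\<tau> ` Pow {..<k})" by simp
  ultimately show ?thesis by blast
qed

text \<open>There are finitely many monomials, so the union of their parameter sets is finite. It is
  fixed before the polynomial, which is what later makes the number of extra ridge functions
  uniform.\<close>

lemma polys_eq_ridge_powers:
  fixes l l' :: real
  assumes l: "l < l'"
  shows "\<exists>T. finite T \<and> T \<subseteq> sphere (0 :: real^'n::finite) 1 \<times> {l..l'} \<and>
    (\<forall>P\<in>polys k. \<exists>c. \<forall>x. P x = (\<Sum>t\<in>T. c t * (fst t \<bullet> x - snd t) ^ k))"
proof -
  let ?A = "{\<alpha> :: 'n \<Rightarrow> nat. mi_degree \<alpha> \<le> k}"
  have "\<forall>\<alpha>\<in>?A. \<exists>T. finite T \<and> T \<subseteq> sphere (0 :: real^'n) 1 \<times> {l..l'} \<and>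
      (\<exists>c. \<forall>x :: real^'n. (\<Prod>i\<in>UNIV. x $ i ^ \<alpha> i) = (\<Sum>t\<in>T. c t * (fst t \<bullet> x - snd t) ^ k))"
  proof
    fix \<alpha> :: "'n \<Rightarrow> nat" assume "\<alpha> \<in> ?A"
    then have "mi_degree \<alpha> \<le> k" by simp
    from monomial_eq_ridge_powers[OF this l] obtain T c where
      "finite T" "T \<subseteq> sphere (0 :: real^'n) 1 \<times> {l..l'}"
      "\<forall>x :: real^'n. (\<Prod>i\<in>UNIV. x $ i ^ \<alpha> i) = (\<Sum>t\<in>T. c t * (fst t \<bullet> x - snd t) ^ k)"
      by blast
    then show "\<exists>T. finite T \<and> T \<subseteq> sphere (0 :: real^'n) 1 \<times> {l..l'} \<and>
        (\<exists>c. \<forall>x :: real^'n. (\<Prod>i\<in>UNIV. x $ i ^ \<alpha> i) = (\<Sum>t\<in>T. c t * (fst t \<bullet> x - snd t) ^ k))"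
      by blast
  qed
  from bchoice[OF this] obtain T where T: "\<forall>\<alpha>\<in>?A. finite (T \<alpha>) \<and> T \<alpha> \<subseteq> sphere (0 :: real^'n) 1 \<times> {l..l'} \<and>
      (\<exists>c. \<forall>x :: real^'n. (\<Prod>i\<in>UNIV. x $ i ^ \<alpha> i) = (\<Sum>t\<in>T \<alpha>. c t * (fst t \<bullet> x - snd t) ^ k))" ..
  then have "\<forall>\<alpha>\<in>?A. \<exists>c. \<forall>x :: real^'n. (\<Prod>i\<in>UNIV. x $ i ^ \<alpha> i) = (\<Sum>t\<in>T \<alpha>. c t * (fst t \<bullet> x - snd t) ^ k)"
    by (simp only: ball_conj_distrib) (elim conjE)
  from bchoice[OF this] obtain c where c: "\<forall>\<alpha>\<in>?A. \<forall>x :: real^'n.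
      (\<Prod>i\<in>UNIV. x $ i ^ \<alpha> i) = (\<Sum>t\<in>T \<alpha>. c \<alpha> t * (fst t \<bullet> x - snd t) ^ k)" ..
  let ?T = "\<Union>\<alpha>\<in>?A. T \<alpha>"
  have fin_T: "finite ?T" using finite_mi_degree_le T by (intro finite_UN_I) simp_all
  have "\<exists>c. \<forall>x. P x = (\<Sum>t\<in>?T. c t * (fst t \<bullet> x - snd t) ^ k)" if "P \<in> polys k" for P
  proof -
    from that obtain p where p: "\<And>x. P x = (\<Sum>\<alpha>\<in>?A. p \<alpha> * (\<Prod>i\<in>UNIV. x $ i ^ \<alpha> i))"
      by (auto simp: polys_def)
    have mono: "(\<Prod>i\<in>UNIV. x $ i ^ \<alpha> i) = (\<Sum>t\<in>?T. (if t \<in> T \<alpha> then c \<alpha> t else 0) * (fst t \<bullet> x - snd t) ^ k)"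
      if "\<alpha> \<in> ?A" for \<alpha> x
    proof -
      have "(\<Sum>t\<in>?T. (if t \<in> T \<alpha> then c \<alpha> t else 0) * (fst t \<bullet> x - snd t) ^ k) =
          (\<Sum>t\<in>T \<alpha>. c \<alpha> t * (fst t \<bullet> x - snd t) ^ k)"
        by (rule sum.mono_neutral_cong_right[OF fin_T]) (use that in auto)
      with c that show ?thesis by simp
    qed
    have "P x = (\<Sum>t\<in>?T. (\<Sum>\<alpha>\<in>?A. p \<alpha> * (if t \<in> T \<alpha> then c \<alpha> t else 0)) * (fst t \<bullet> x - snd t) ^ k)" for x
    proof -
      have "P x = (\<Sum>\<alpha>\<in>?A. p \<alpha> * (\<Sum>t\<in>?T. (if t \<in> T \<alpha> then c \<alpha> t else 0) * (fst t \<bullet> x - snd t) ^ k))"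
        unfolding p by (intro sum.cong refl arg_cong2[of _ _ _ _ "(*)"] mono)
      also have "\<dots> = (\<Sum>\<alpha>\<in>?A. \<Sum>t\<in>?T. p \<alpha> * (if t \<in> T \<alpha> then c \<alpha> t else 0) * (fst t \<bullet> x - snd t) ^ k)"
        by (simp only: sum_distrib_left mult.assoc)
      also have "\<dots> = (\<Sum>t\<in>?T. \<Sum>\<alpha>\<in>?A. p \<alpha> * (if t \<in> T \<alpha> then c \<alpha> t else 0) * (fst t \<bullet> x - snd t) ^ k)"
        by (rule sum.swap)
      finally show ?thesis
        by (simp only: sum_distrib_right)
    qed
    then show ?thesis
      by (intro exI[of _ "\<lambda>t. \<Sum>\<alpha>\<in>?A. p \<alpha> * (if t \<in> T \<alpha> then c \<alpha> t else 0)"] allI)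
  qed
  moreover have "?T \<subseteq> sphere 0 1 \<times> {l..l'}" using T by (intro UN_least) simp
  ultimately show ?thesis
    using fin_T by (intro exI[of _ ?T] conjI ballI)
qed

section \<open>Bounded coefficients\<close>

text \<open>The part of \<open>\<Omega>\<close> where \<open>h\<close> is nonzero is open and null,
  hence empty.\<close>

lemma continuous_AE_eq_0:
  fixes h :: "real^'n::finite \<Rightarrow> real"
  assumes h: "continuous_on UNIV h" and \<Omega>: "open \<Omega>"
    and ae: "AE x in lebesgue_on \<Omega>. h x = 0" and x: "x \<in> \<Omega>"
  shows "h x = 0"
proof -
  let ?U = "{x. h x \<noteq> 0} \<inter> \<Omega>"
  have "AE x in lebesgue. x \<notin> ?U"
    using ae \<Omega> by (simp add: AE_restrict_space_iff borel_open) (auto elim: eventually_mono)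
  moreover have U: "open ?U"
    using h \<Omega> by (intro open_Int open_Collect_neq continuous_on_const)
  ultimately have "negligible ?U"
    using AE_iff_null_sets[of ?U lebesgue] by (simp add: negligible_iff_null_sets borel_open)
  with U have "?U = {}"
    using open_not_negligible by blast
  with x show ?thesis by blast
qed

text \<open>Pinning the coefficients outside \<open>T\<close> to zero places the set in a product of
  compact intervals, compact by Tychonoff even when the index type is infinite; the norm condition
  is closed.\<close>

lemma compact_coefficient_sphere:
  fixes T :: "'a set"
  assumes "finite T"
  shows "compact {c :: 'a \<Rightarrow> real. (\<forall>t. t \<notin> T \<longrightarrow> c t = 0) \<and> (\<Sum>t\<in>T. \<bar>c t\<bar>) = 1}"
proof -
  let ?B = "\<lambda>t. if t \<in> T then {-1..1} else {0 :: real}"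
  have "compact (Pi\<^sub>E UNIV ?B)"
    using compactin_PiE[of "\<lambda>_. euclidean" UNIV ?B] by (simp add: euclidean_product_topology)
  moreover have "closed {c :: 'a \<Rightarrow> real. (\<Sum>t\<in>T. \<bar>c t\<bar>) = 1}"
    by (intro closed_Collect_eq continuous_intros continuous_on_product_coordinates)
  ultimately have "compact (Pi\<^sub>E UNIV ?B \<inter> {c. (\<Sum>t\<in>T. \<bar>c t\<bar>) = 1})"
    by (rule compact_Int_closed)
  also have "Pi\<^sub>E UNIV ?B \<inter> {c. (\<Sum>t\<in>T. \<bar>c t\<bar>) = 1} =
      {c. (\<forall>t. t \<notin> T \<longrightarrow> c t = 0) \<and> (\<Sum>t\<in>T. \<bar>c t\<bar>) = 1}"
  proof (intro set_eqI iffI)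
    fix c assume c: "c \<in> {c :: 'a \<Rightarrow> real. (\<forall>t. t \<notin> T \<longrightarrow> c t = 0) \<and> (\<Sum>t\<in>T. \<bar>c t\<bar>) = 1}"
    have "\<bar>c t\<bar> \<le> 1" if "t \<in> T" for t
      using member_le_sum[OF that, of "\<lambda>t. \<bar>c t\<bar>"] assms c by simp
    with c show "c \<in> Pi\<^sub>E UNIV ?B \<inter> {c. (\<Sum>t\<in>T. \<bar>c t\<bar>) = 1}"
      by (auto simp: PiE_iff abs_le_iff minus_le_iff)
  qed (auto simp: PiE_iff split: if_splits)
  finally show ?thesis .
qed

text \<open>Equivalence of norms in finite dimension: the squared L2 norm attains its minimum on the
  compact coefficient sphere, independence makes this minimum positive, and homogeneity extends the
  bound to all coefficients.\<close>

lemma bounded_coefficients_if_independent: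
  fixes F :: "'a \<Rightarrow> real^'n::finite \<Rightarrow> real"
  assumes \<Omega>: "open \<Omega>" "bounded \<Omega>" and T: "finite T"
    and F: "\<And>t. t \<in> T \<Longrightarrow> continuous_on UNIV (F t)"
    and indep: "\<And>c. (\<forall>x\<in>\<Omega>. (\<Sum>t\<in>T. c t * F t x) = 0) \<Longrightarrow> \<forall>t\<in>T. c t = 0"
  shows "\<exists>C\<ge>0. \<forall>c. (\<Sum>t\<in>T. \<bar>c t\<bar>) \<le> C * sqrt (\<integral>x. (\<Sum>t\<in>T. c t * F t x)\<^sup>2 \<partial>lebesgue_on \<Omega>)"
proof (cases "T = {}")
  case False
  define Q where "Q c = (\<integral>x. (\<Sum>t\<in>T. c t * F t x)\<^sup>2 \<partial>lebesgue_on \<Omega>)" for c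
  define K where "K = {c :: 'a \<Rightarrow> real. (\<forall>t. t \<notin> T \<longrightarrow> c t = 0) \<and> (\<Sum>t\<in>T. \<bar>c t\<bar>) = 1}"
  have cont: "continuous_on UNIV (\<lambda>x. \<Sum>t\<in>T. c t * F t x)" for c
    using F by (intro continuous_intros)
  have meas: "\<Omega> \<in> sets lebesgue"
    using \<Omega>(1) by (simp add: borel_open)
  have int: "integrable (lebesgue_on \<Omega>) h" if "continuous_on UNIV h" for h :: "real^'n \<Rightarrow> real"
    using absolutely_integrable_on_bounded_if_continuous[OF that \<Omega>(2) meas] meas
    by (rule absolutely_integrable_imp_integrable)
  \<comment> \<open>As an explicit quadratic form in finitely many coordinates, \<open>Q\<close> is
    visibly continuous for the product topology and homogeneous of degree two.\<close>
  have Q_eq: "Q c = (\<Sum>s\<in>T. \<Sum>t\<in>T. c s * c t * (\<integral>x. F s x * F t x \<partial>lebesgue_on \<Omega>))" for c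
  proof -
    have "Q c = (\<integral>x. (\<Sum>s\<in>T. \<Sum>t\<in>T. c s * c t * (F s x * F t x)) \<partial>lebesgue_on \<Omega>)"
      unfolding Q_def by (simp add: power2_eq_square sum_product ac_simps)
    also have "\<dots> = (\<Sum>s\<in>T. \<Sum>t\<in>T. \<integral>x. c s * c t * (F s x * F t x) \<partial>lebesgue_on \<Omega>)"
    proof -
      have "integrable (lebesgue_on \<Omega>) (\<lambda>x. c s * c t * (F s x * F t x))" if "s \<in> T" "t \<in> T" for s t
        using that F by (intro int continuous_intros) auto
      then show ?thesis
        by (simp add: Bochner_Integration.integral_sum Bochner_Integration.integrable_sum)
    qed
    finally show ?thesis by simp
  qed
  have "continuous_on K Q"
    unfolding Q_eq by (intro continuous_intros continuous_on_subset[OF continuous_on_product_coordinates]) auto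
  moreover have "K \<noteq> {}"
  proof -
    obtain a where "a \<in> T" using False by blast
    then have "(\<lambda>t. if t = a then 1 else 0) \<in> K"
      using T by (auto simp: K_def if_distrib[of abs] cong: if_cong)
    then show ?thesis by blast
  qed
  ultimately obtain c\<^sub>0 where c\<^sub>0: "c\<^sub>0 \<in> K" and min: "\<And>c. c \<in> K \<Longrightarrow> Q c\<^sub>0 \<le> Q c"
    using continuous_attains_inf[of K Q] compact_coefficient_sphere[OF T] unfolding K_def[symmetric] by blast
  have nz: "Q c\<^sub>0 \<noteq> 0"
  proof
    assume "Q c\<^sub>0 = 0"
    then have "AE x in lebesgue_on \<Omega>. (\<Sum>t\<in>T. c\<^sub>0 t * F t x)\<^sup>2 = 0"
      unfolding Q_def using cont by (subst (asm) integral_nonneg_eq_0_iff_AE) (simp_all add: int continuous_on_power)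
    then have "AE x in lebesgue_on \<Omega>. (\<Sum>t\<in>T. c\<^sub>0 t * F t x) = 0"
      by simp
    then have "\<forall>t\<in>T. c\<^sub>0 t = 0"
      using continuous_AE_eq_0[OF cont \<Omega>(1)] by (intro indep) blast
    with c\<^sub>0 show False by (simp add: K_def)
  qed
  have Q_nonneg: "0 \<le> Q c" for c
    by (simp add: Q_def)
  have pos: "Q c\<^sub>0 > 0"
    using nz Q_nonneg[of c\<^sub>0] by linarith
  have "(\<Sum>t\<in>T. \<bar>c t\<bar>) \<le> 1 / sqrt (Q c\<^sub>0) * sqrt (Q c)" for c
  proof (cases "(\<Sum>t\<in>T. \<bar>c t\<bar>) = 0")
    case False
    define s where "s = (\<Sum>t\<in>T. \<bar>c t\<bar>)"
    have s: "s > 0"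
      unfolding s_def by (rule order_le_neq_trans[OF sum_nonneg]) (use False in simp_all)
    \<comment> \<open>Besides rescaling, coefficients outside \<open>T\<close> are reset to zero, as
      membership in \<open>K\<close> demands; \<open>Q\<close> does not see them.\<close>
    let ?c = "\<lambda>t. if t \<in> T then c t / s else 0"
    have "?c \<in> K"
      using s by (simp add: K_def sum_divide_distrib[symmetric] s_def[symmetric])
    then have "Q c\<^sub>0 \<le> Q ?c" by (rule min)
    also have "Q ?c = Q c / s\<^sup>2"
      unfolding Q_eq by (simp add: sum_divide_distrib power2_eq_square)
    finally have "s\<^sup>2 * Q c\<^sub>0 \<le> Q c"
      using s by (simp add: field_simps)
    then have "sqrt (s\<^sup>2 * Q c\<^sub>0) \<le> sqrt (Q c)" by simp
    then show ?thesis
      using s pos by (simp add: real_sqrt_mult s_def[symmetric] field_simps)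
  qed (use pos Q_nonneg in simp)
  moreover have "0 \<le> 1 / sqrt (Q c\<^sub>0)"
    using pos by simp
  ultimately show ?thesis
    unfolding Q_def by blast
qed auto

text \<open>The coefficients are not unique when the family is linearly dependent on \<open>\<Omega>\<close>; dependent members
  are eliminated one at a time.\<close>

lemma bounded_coefficients:
  fixes F :: "'a \<Rightarrow> real^'n::finite \<Rightarrow> real"
  assumes \<Omega>: "open \<Omega>" "bounded \<Omega>" and T: "finite T"
    and F: "\<And>t. t \<in> T \<Longrightarrow> continuous_on UNIV (F t)"
  shows "\<exists>C\<ge>0. \<forall>c. \<exists>c'. (\<forall>x\<in>\<Omega>. (\<Sum>t\<in>T. c' t * F t x) = (\<Sum>t\<in>T. c t * F t x)) \<and>
    (\<Sum>t\<in>T. \<bar>c' t\<bar>) \<le> C * sqrt (\<integral>x. (\<Sum>t\<in>T. c t * F t x)\<^sup>2 \<partial>lebesgue_on \<Omega>)"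
  using T F
proof (induction T rule: finite_psubset_induct)
  case (psubset T)
  show ?case
  proof (cases "\<exists>d. (\<forall>x\<in>\<Omega>. (\<Sum>t\<in>T. d t * F t x) = 0) \<and> (\<exists>a\<in>T. d a \<noteq> 0)")
    case False
    then have "\<exists>C\<ge>0. \<forall>c. (\<Sum>t\<in>T. \<bar>c t\<bar>) \<le> C * sqrt (\<integral>x. (\<Sum>t\<in>T. c t * F t x)\<^sup>2 \<partial>lebesgue_on \<Omega>)"
      using psubset.hyps psubset.prems by (intro bounded_coefficients_if_independent[OF \<Omega>]) blast+
    then show ?thesis by blast
  next
    case True
    then obtain d a where d: "\<And>x. x \<in> \<Omega> \<Longrightarrow> (\<Sum>t\<in>T. d t * F t x) = 0" and a: "a \<in> T" "d a \<noteq> 0"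
      by blast
    let ?T = "T - {a}"
    have "\<exists>C\<ge>0. \<forall>c. \<exists>c'. (\<forall>x\<in>\<Omega>. (\<Sum>t\<in>?T. c' t * F t x) = (\<Sum>t\<in>?T. c t * F t x)) \<and>
        (\<Sum>t\<in>?T. \<bar>c' t\<bar>) \<le> C * sqrt (\<integral>x. (\<Sum>t\<in>?T. c t * F t x)\<^sup>2 \<partial>lebesgue_on \<Omega>)"
      using a psubset.prems by (intro psubset.IH) auto
    then obtain C where C: "C \<ge> 0" and IH: "\<And>c. \<exists>c'. (\<forall>x\<in>\<Omega>. (\<Sum>t\<in>?T. c' t * F t x) = (\<Sum>t\<in>?T. c t * F t x)) \<and>
        (\<Sum>t\<in>?T. \<bar>c' t\<bar>) \<le> C * sqrt (\<integral>x. (\<Sum>t\<in>?T. c t * F t x)\<^sup>2 \<partial>lebesgue_on \<Omega>)"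
      by blast
    have "\<exists>c'. (\<forall>x\<in>\<Omega>. (\<Sum>t\<in>T. c' t * F t x) = (\<Sum>t\<in>T. c t * F t x)) \<and>
        (\<Sum>t\<in>T. \<bar>c' t\<bar>) \<le> C * sqrt (\<integral>x. (\<Sum>t\<in>T. c t * F t x)\<^sup>2 \<partial>lebesgue_on \<Omega>)" for c
    proof -
      \<comment> \<open>Subtracting a multiple of the relation \<open>d\<close> removes the
        coefficient at \<open>a\<close> and leaves the sum unchanged on
        \<open>\<Omega>\<close>.\<close>
      define e where "e t = c t - c a / d a * d t" for t
      have e: "(\<Sum>t\<in>?T. e t * F t x) = (\<Sum>t\<in>T. c t * F t x)" if "x \<in> \<Omega>" for x
      proof -
        have "(\<Sum>t\<in>T. e t * F t x) = (\<Sum>t\<in>T. c t * F t x) - c a / d a * (\<Sum>t\<in>T. d t * F t x)"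
          by (simp add: e_def left_diff_distrib sum_subtractf sum_distrib_left mult.assoc)
        then show ?thesis
          using a psubset.hyps d[OF that] sum.remove[of T a "\<lambda>t. e t * F t x"] by (simp add: e_def)
      qed
      obtain e' where e': "\<And>x. x \<in> \<Omega> \<Longrightarrow> (\<Sum>t\<in>?T. e' t * F t x) = (\<Sum>t\<in>?T. e t * F t x)"
        "(\<Sum>t\<in>?T. \<bar>e' t\<bar>) \<le> C * sqrt (\<integral>x. (\<Sum>t\<in>?T. e t * F t x)\<^sup>2 \<partial>lebesgue_on \<Omega>)"
        using IH by blast
      have "(\<integral>x. (\<Sum>t\<in>?T. e t * F t x)\<^sup>2 \<partial>lebesgue_on \<Omega>) = (\<integral>x. (\<Sum>t\<in>T. c t * F t x)\<^sup>2 \<partial>lebesgue_on \<Omega>)"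
        by (rule Bochner_Integration.integral_cong) (simp_all add: e)
      moreover have "(\<Sum>t\<in>T. (e'(a := 0)) t * F t x) = (\<Sum>t\<in>?T. e' t * F t x)" for x
        using a psubset.hyps by (subst sum.remove[of T a]) (auto intro: sum.cong)
      moreover have "(\<Sum>t\<in>T. \<bar>(e'(a := 0)) t\<bar>) = (\<Sum>t\<in>?T. \<bar>e' t\<bar>)"
        using a psubset.hyps by (subst sum.remove[of T a]) (auto intro: sum.cong)
      ultimately show ?thesis
        using e e' by (intro exI[of _ "e'(a := 0)"]) simp
    qed
    with C show ?thesis by blast
  qed
qed

section \<open>Ridge sums\<close>

lemma relu_pow_eq_power: "0 \<le> t \<Longrightarrow> relu_pow k t = t ^ k"
  by (simp add: relu_pow_def)

lemma abs_relu_pow_le: "\<bar>relu_pow k t\<bar> \<le> \<bar>t\<bar> ^ k"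
  by (auto simp: relu_pow_def abs_if max_def power_mono)

lemma continuous_on_ridge_sum: "continuous_on UNIV (ridge_sum k N a \<omega> b)"
  unfolding ridge_sum_def[abs_def] relu_pow_def by (intro continuous_intros)

lemma continuous_on_polys: "P \<in> polys k \<Longrightarrow> continuous_on UNIV P"
  by (auto simp: polys_def fun_eq_iff[symmetric] intro!: continuous_intros)

text \<open>Offsets are at most \<open>l'\<close>, which lies below every value of the inner product
  on \<open>\<Omega>\<close>; there the truncation in \<open>relu_pow\<close> is inactive and ridge
  functions coincide with the powers spanning \<open>polys k\<close>. Both \<open>K\<close> and
  \<open>C\<close> are independent of \<open>P\<close>.\<close>

lemma poly_eq_ridge_sum:
  fixes \<Omega> :: "(real^'n::finite) set" and l l' :: real
  assumes \<Omega>: "open \<Omega>" "bounded \<Omega>" and l: "l < l'"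
    and above: "\<And>x \<omega>. x \<in> \<Omega> \<Longrightarrow> norm \<omega> = 1 \<Longrightarrow> l' \<le> \<omega> \<bullet> x"
  shows "\<exists>K. \<exists>C\<ge>0. \<forall>P\<in>polys k. \<exists>a \<omega> b.
    (\<forall>r\<in>{1..K}. norm (\<omega> r) = 1 \<and> b r \<in> {l..l'}) \<and>
    (\<forall>x\<in>\<Omega>. P x = ridge_sum k K a \<omega> b x) \<and>
    (\<Sum>r=1..K. \<bar>a r\<bar>) \<le> C * sqrt (\<integral>x. (P x)\<^sup>2 \<partial>lebesgue_on \<Omega>)"
proof -
  obtain T where T: "finite T" "T \<subseteq> sphere (0 :: real^'n) 1 \<times> {l..l'}"
    and span: "\<forall>P\<in>polys k. \<exists>c. \<forall>x. P x = (\<Sum>t\<in>T. c t * (fst t \<bullet> x - snd t) ^ k)"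
    using polys_eq_ridge_powers[OF l, of k] by (elim exE conjE) (rule that)
  define F where "F t x = (fst t \<bullet> x - snd t) ^ k" for t :: "(real^'n) \<times> real" and x
  have "continuous_on UNIV (F t)" for t
    unfolding F_def by (intro continuous_intros)
  from bounded_coefficients[where F = F, OF \<Omega> T(1) this] obtain C where C: "C \<ge> 0"
    and coeff: "\<And>c. \<exists>c'. (\<forall>x\<in>\<Omega>. (\<Sum>t\<in>T. c' t * F t x) = (\<Sum>t\<in>T. c t * F t x)) \<and>
      (\<Sum>t\<in>T. \<bar>c' t\<bar>) \<le> C * sqrt (\<integral>x. (\<Sum>t\<in>T. c t * F t x)\<^sup>2 \<partial>lebesgue_on \<Omega>)"
    by blast
  obtain g where g: "bij_betw g {1..card T} T"
    using ex_bij_betw_nat_finite_1[OF T(1)] by blast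
  have params: "norm (fst (g r)) = 1 \<and> snd (g r) \<in> {l..l'}" if "r \<in> {1..card T}" for r
  proof -
    have "g r \<in> sphere 0 1 \<times> {l..l'}"
      using bij_betwE[OF g] that T(2) by blast
    then show ?thesis by (auto simp: mem_Times_iff)
  qed
  have "\<exists>a \<omega> b. (\<forall>r\<in>{1..card T}. norm (\<omega> r) = 1 \<and> b r \<in> {l..l'}) \<and>
      (\<forall>x\<in>\<Omega>. P x = ridge_sum k (card T) a \<omega> b x) \<and>
      (\<Sum>r=1..card T. \<bar>a r\<bar>) \<le> C * sqrt (\<integral>x. (P x)\<^sup>2 \<partial>lebesgue_on \<Omega>)"
    if "P \<in> polys k" for P
  proof -
    from bspec[OF span that] obtain c where "\<forall>x. P x = (\<Sum>t\<in>T. c t * (fst t \<bullet> x - snd t) ^ k)" ..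
    then have c: "(\<Sum>t\<in>T. c t * F t x) = P x" for x
      by (simp add: F_def)
    from coeff[of c] obtain c' where "(\<forall>x\<in>\<Omega>. (\<Sum>t\<in>T. c' t * F t x) = P x) \<and>
        (\<Sum>t\<in>T. \<bar>c' t\<bar>) \<le> C * sqrt (\<integral>x. (P x)\<^sup>2 \<partial>lebesgue_on \<Omega>)"
      unfolding c ..
    then have c': "\<And>x. x \<in> \<Omega> \<Longrightarrow> (\<Sum>t\<in>T. c' t * F t x) = P x"
      "(\<Sum>t\<in>T. \<bar>c' t\<bar>) \<le> C * sqrt (\<integral>x. (P x)\<^sup>2 \<partial>lebesgue_on \<Omega>)"
      by simp_all
    let ?a = "\<lambda>r. c' (g r)" and ?\<omega> = "\<lambda>r. fst (g r)" and ?b = "\<lambda>r. snd (g r)"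
    have "P x = ridge_sum k (card T) ?a ?\<omega> ?b x" if x: "x \<in> \<Omega>" for x
    proof -
      have "P x = (\<Sum>t\<in>T. c' t * F t x)"
        using c'(1)[OF x] by simp
      also have "\<dots> = (\<Sum>r=1..card T. c' (g r) * F (g r) x)"
        by (rule sum.reindex_bij_betw[OF g, symmetric])
      also have "\<dots> = ridge_sum k (card T) ?a ?\<omega> ?b x"
        unfolding ridge_sum_def F_def
      proof (rule sum.cong[OF refl])
        fix r assume "r \<in> {1..card T}"
        from params[OF this] above[OF x, of "fst (g r)"] have "0 \<le> fst (g r) \<bullet> x - snd (g r)"
          by simp
        then show "c' (g r) * (fst (g r) \<bullet> x - snd (g r)) ^ k = c' (g r) * relu_pow k (fst (g r) \<bullet> x - snd (g r))"
          by (simp add: relu_pow_eq_power)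
      qed
      finally show ?thesis .
    qed
    moreover have "(\<Sum>r=1..card T. \<bar>?a r\<bar>) \<le> C * sqrt (\<integral>x. (P x)\<^sup>2 \<partial>lebesgue_on \<Omega>)"
      using c'(2) sum.reindex_bij_betw[OF g, of "\<lambda>t. \<bar>c' t\<bar>"] by simp
    ultimately show ?thesis
      using params by (intro exI[of _ ?a] exI[of _ ?\<omega>] exI[of _ ?b]) simp
  qed
  with C show ?thesis by blast
qed

section \<open>Concatenation of ridge sums\<close>

lemma sum_append:
  fixes f g :: "nat \<Rightarrow> 'a::comm_monoid_add"
  shows "(\<Sum>r=1..N + K. if r \<le> N then f r else g (r - N)) = (\<Sum>r=1..N. f r) + (\<Sum>r=1..K. g r)"
proof -
  have "(\<Sum>r=1..N + K. if r \<le> N then f r else g (r - N)) =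
      (\<Sum>r=1..N. if r \<le> N then f r else g (r - N)) + (\<Sum>r=N+1..N + K. if r \<le> N then f r else g (r - N))"
    by (rule sum.ub_add_nat) simp
  also have "(\<Sum>r=N+1..N + K. if r \<le> N then f r else g (r - N)) = (\<Sum>r=1+N..K+N. if r \<le> N then f r else g (r - N))"
    by (simp add: add.commute)
  also have "\<dots> = (\<Sum>r=1..K. g r)"
    unfolding sum.shift_bounds_cl_nat_ivl by (rule sum.cong) auto
  finally show ?thesis by simp
qed

lemma ridge_sum_add_in_ridge_class:
  assumes 1: "\<And>r. r \<in> {1..N} \<Longrightarrow> norm (\<omega> r) = 1 \<and> b r \<in> {b\<^sub>m..b\<^sub>p}"
    and 2: "\<And>r. r \<in> {1..K} \<Longrightarrow> norm (\<omega>' r) = 1 \<and> b' r \<in> {b\<^sub>m..b\<^sub>p}"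
    and n: "N + K \<le> n" and M: "(\<Sum>r=1..N. \<bar>a r\<bar>) + (\<Sum>r=1..K. \<bar>a' r\<bar>) \<le> M"
  shows "(\<lambda>x. ridge_sum k N a \<omega> b x + ridge_sum k K a' \<omega>' b' x) \<in> ridge_class k b\<^sub>m b\<^sub>p n (ennreal M)"
proof -
  let ?a = "\<lambda>r. if r \<le> N then a r else a' (r - N)"
    and ?\<omega> = "\<lambda>r. if r \<le> N then \<omega> r else \<omega>' (r - N)"
    and ?b = "\<lambda>r. if r \<le> N then b r else b' (r - N)"
  have "ridge_sum k (N + K) ?a ?\<omega> ?b = (\<lambda>x. ridge_sum k N a \<omega> b x + ridge_sum k K a' \<omega>' b' x)"
  proof
    fix x
    show "ridge_sum k (N + K) ?a ?\<omega> ?b x = ridge_sum k N a \<omega> b x + ridge_sum k K a' \<omega>' b' x"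
      unfolding ridge_sum_def sum_append[symmetric] by (rule sum.cong) auto
  qed
  moreover have "(\<Sum>r=1..N + K. \<bar>?a r\<bar>) \<le> M"
    using M unfolding sum_append[symmetric] by (simp only: if_distrib[of abs])
  moreover have "norm (?\<omega> r) = 1 \<and> ?b r \<in> {b\<^sub>m..b\<^sub>p}" if "r \<in> {1..N + K}" for r
  proof (cases "r \<le> N")
    case True
    then show ?thesis using 1[of r] that by simp
  next
    case False
    with that have "r - N \<in> {1..K}" by auto
    from 2[OF this] False show ?thesis by simp
  qed
  ultimately show ?thesis
    unfolding ridge_class_def using n
    by (intro CollectI exI[of _ "N + K"] exI[of _ ?a] exI[of _ ?\<omega>] exI[of _ ?b]) (simp add: ennreal_leI)
qed

lemma zero_in_ridge_class: "0 \<le> M \<Longrightarrow> (\<lambda>_. 0) \<in> ridge_class k b\<^sub>m b\<^sub>p n (ennreal M)"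
  unfolding ridge_class_def
  by (intro CollectI exI[of _ 0] exI[of _ "\<lambda>_. 0"]) (simp add: ridge_sum_def fun_eq_iff)

section \<open>The approximation rate with its logarithmic factor\<close>

definition log_rate :: "real \<Rightarrow> real \<Rightarrow> nat \<Rightarrow> real" where
  "log_rate \<gamma> \<kappa> n = real n powr (-\<gamma>) * (1 + ln (2 + real n)) powr \<kappa>"

lemma log_rate_nonneg: "0 \<le> log_rate \<gamma> \<kappa> n"
  by (simp add: log_rate_def)

text \<open>The logarithm grows more slowly than any positive power. The exponent \<gamma>/\<kappa>
  is the one whose \<kappa>-th power is cancelled by the decay, which is why \<kappa> = 0 is split
  off.\<close>

lemma log_rate_bounded:
  assumes \<gamma>: "\<gamma> > 0" and \<kappa>: "\<kappa> \<ge> 0"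
  shows "\<exists>S\<ge>0. \<forall>n\<ge>1. log_rate \<gamma> \<kappa> n \<le> S"
proof (cases "\<kappa> = 0")
  case True
  have "log_rate \<gamma> \<kappa> n \<le> 1" if "n \<ge> 1" for n
    using True \<gamma> that powr_mono[of "-\<gamma>" 0 "real n"] by (simp add: log_rate_def)
  then show ?thesis by (intro exI[of _ 1]) simp
next
  case False
  define a where "a = \<gamma> / \<kappa>"
  have a: "a > 0" "a * \<kappa> = \<gamma>" using False \<gamma> \<kappa> by (auto simp: a_def)
  define S where "S = (1 + 1 / a) powr \<kappa> * 3 powr \<gamma>"
  have "log_rate \<gamma> \<kappa> n \<le> S" if n: "n \<ge> 1" for n
  proof -
    have "ln (2 + real n) \<le> (2 + real n) powr a / a"
      using a by (intro ln_powr_bound) auto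
    \<comment> \<open>Uses 2 + n \<le> 3n for n \<ge> 1.\<close>
    also have "(2 + real n) powr a / a \<le> (3 * real n) powr a / a"
      using a n by (intro divide_right_mono powr_mono2) auto
    finally have "ln (2 + real n) \<le> (3 * real n) powr a / a" .
    moreover have "1 \<le> (3 * real n) powr a"
      using a n by (intro ge_one_powr_ge_zero) auto
    ultimately have "1 + ln (2 + real n) \<le> (1 + 1 / a) * (3 * real n) powr a"
      by (simp add: distrib_right)
    moreover have "0 \<le> 1 + ln (2 + real n)" by simp
    ultimately have "(1 + ln (2 + real n)) powr \<kappa> \<le> ((1 + 1 / a) * (3 * real n) powr a) powr \<kappa>"
      using \<kappa> by (intro powr_mono2) auto
    also have "\<dots> = S * real n powr \<gamma>"
      using a n by (simp add: S_def powr_mult powr_powr)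
    finally have "log_rate \<gamma> \<kappa> n \<le> real n powr (-\<gamma>) * (S * real n powr \<gamma>)"
      unfolding log_rate_def by (intro mult_left_mono) auto
    also have "\<dots> = S"
      using n by (simp add: powr_minus)
    finally show ?thesis .
  qed
  moreover have "S \<ge> 0" by (simp add: S_def)
  ultimately show ?thesis by blast
qed

text \<open>The shifted index is at least n/2, so the power costs at most a factor 2^\<gamma>, while
  the logarithmic factor only decreases.\<close>

lemma log_rate_shift:
  assumes \<gamma>: "\<gamma> > 0" and \<kappa>: "\<kappa> \<ge> 0" and n: "n \<ge> 1" "2 * K \<le> n"
  shows "log_rate \<gamma> \<kappa> (n - K) \<le> 2 powr \<gamma> * log_rate \<gamma> \<kappa> n"
proof -
  have "real (n - K) powr (-\<gamma>) \<le> (real n / 2) powr (-\<gamma>)"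
    using \<gamma> n by (intro powr_mono2') (auto simp: of_nat_diff)
  also have "\<dots> = 2 powr \<gamma> * real n powr (-\<gamma>)"
    by (simp add: powr_divide powr_minus field_simps)
  finally have 1: "real (n - K) powr (-\<gamma>) \<le> 2 powr \<gamma> * real n powr (-\<gamma>)" .
  have 2: "(1 + ln (2 + real (n - K))) powr \<kappa> \<le> (1 + ln (2 + real n)) powr \<kappa>"
    using \<kappa> by (intro powr_mono2) auto
  show ?thesis
    using mult_mono[OF 1 2] by (simp add: log_rate_def mult.assoc)
qed

text \<open>On a finite initial range the rate is bounded below, so a fixed error can be absorbed
  into the constant there.\<close>

lemma log_rate_small:
  assumes \<gamma>: "\<gamma> > 0" and \<kappa>: "\<kappa> \<ge> 0" and n: "n \<ge> 1" "n \<le> m"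
  shows "1 \<le> real m powr \<gamma> * log_rate \<gamma> \<kappa> n"
proof -
  have "1 \<le> real m powr \<gamma> * real n powr (-\<gamma>)"
    using \<gamma> n powr_mono2[of \<gamma> "real n" "real m"] by (simp add: powr_minus field_simps)
  moreover have "1 \<le> (1 + ln (2 + real n)) powr \<kappa>"
    using \<kappa> by (intro ge_one_powr_ge_zero) auto
  ultimately have "1 * 1 \<le> (real m powr \<gamma> * real n powr (-\<gamma>)) * (1 + ln (2 + real n)) powr \<kappa>"
    by (intro mult_mono) auto
  then show ?thesis
    by (simp add: log_rate_def mult.assoc)
qed

section \<open>Uniform bounds for the ridge part\<close>

lemma ridge_sum_bound:
  assumes x: "norm x \<le> R" and params: "\<And>r. r \<in> {1..N} \<Longrightarrow> norm (\<omega> r) = 1 \<and> b r \<in> {b\<^sub>m..b\<^sub>p}"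
  shows "\<bar>ridge_sum k N a \<omega> b x\<bar> \<le> (\<Sum>r=1..N. \<bar>a r\<bar>) * (R + \<bar>b\<^sub>m\<bar> + \<bar>b\<^sub>p\<bar>) ^ k"
proof -
  have "\<bar>a r * relu_pow k (\<omega> r \<bullet> x - b r)\<bar> \<le> \<bar>a r\<bar> * (R + \<bar>b\<^sub>m\<bar> + \<bar>b\<^sub>p\<bar>) ^ k" if r: "r \<in> {1..N}" for r
  proof -
    have "\<bar>\<omega> r \<bullet> x\<bar> \<le> R"
      using Cauchy_Schwarz_ineq2[of "\<omega> r" x] params[OF r] x by simp
    moreover have "\<bar>b r\<bar> \<le> \<bar>b\<^sub>m\<bar> + \<bar>b\<^sub>p\<bar>"
      using params[OF r] by auto
    ultimately have "\<bar>\<omega> r \<bullet> x - b r\<bar> \<le> R + \<bar>b\<^sub>m\<bar> + \<bar>b\<^sub>p\<bar>"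
      by linarith
    then have "\<bar>\<omega> r \<bullet> x - b r\<bar> ^ k \<le> (R + \<bar>b\<^sub>m\<bar> + \<bar>b\<^sub>p\<bar>) ^ k"
      by (intro power_mono) auto
    with abs_relu_pow_le have "\<bar>relu_pow k (\<omega> r \<bullet> x - b r)\<bar> \<le> (R + \<bar>b\<^sub>m\<bar> + \<bar>b\<^sub>p\<bar>) ^ k"
      by (rule order_trans)
    then show ?thesis
      unfolding abs_mult by (rule mult_left_mono) simp
  qed
  then show ?thesis
    unfolding ridge_sum_def sum_distrib_right by (intro order_trans[OF sum_abs] sum_mono)
qed

lemma L2_bounded_le:
  fixes h :: "real^'n::finite \<Rightarrow> real"
  assumes \<Omega>: "open \<Omega>" "bounded \<Omega>" and h: "continuous_on UNIV h" and B: "\<And>x. x \<in> \<Omega> \<Longrightarrow> \<bar>h x\<bar> \<le> B"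
  shows "(\<integral>x. (h x)\<^sup>2 \<partial>lebesgue_on \<Omega>) \<le> B\<^sup>2 * measure lebesgue \<Omega>"
proof -
  have L: "\<Omega> \<in> lmeasurable"
    using \<Omega> by (simp add: lmeasurable_open)
  have "(\<integral>x. (h x)\<^sup>2 \<partial>lebesgue_on \<Omega>) \<le> (\<integral>x. B\<^sup>2 \<partial>lebesgue_on \<Omega>)"
  proof (rule integral_mono)
    show "integrable (lebesgue_on \<Omega>) (\<lambda>x. (h x)\<^sup>2)"
      using L2_space_continuous[OF h \<Omega>] by (simp add: L2_space_def)
    show "integrable (lebesgue_on \<Omega>) (\<lambda>x. B\<^sup>2)"
      using finite_measure_lebesgue_on[OF L] by (rule finite_measure.integrable_const)
    show "(h x)\<^sup>2 \<le> B\<^sup>2" if "x \<in> space (lebesgue_on \<Omega>)" for x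
      using power_mono[OF B, of x 2] that by simp
  qed
  also have "\<dots> = B\<^sup>2 * measure lebesgue \<Omega>"
    using L by (simp add: measure_restrict_space fmeasurableD mult.commute)
  finally show ?thesis .
qed

section \<open>Absorption of the polynomial part into the ridge sum\<close>

theorem proposition2p3:
  fixes \<Omega> :: "(real^'n::finite) set"
    and k m :: nat
    and b\<^sub>m b\<^sub>p :: real
    and q :: "'x::real_vector \<Rightarrow> real"
    and \<iota> :: "'x \<Rightarrow> real^'n \<Rightarrow> real"
    and \<gamma> \<kappa> M\<^sub>0 :: real
  assumes dim: "CARD('n) \<ge> 2"
    and dom: "bounded_lipschitz_domain \<Omega>"
    and k: "k \<ge> 1"
    and m: "m \<le> k"
    and bm: "b\<^sub>m < (INF (x, \<omega>)\<in>\<Omega> \<times> sphere 0 1. \<omega> \<bullet> x) - 1"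
    and bp: "b\<^sub>p > (SUP (x, \<omega>)\<in>\<Omega> \<times> sphere 0 1. \<omega> \<bullet> x) + 1"
    and X: "quasi_banach q"
    and emb: "continuous_embedding q \<Omega> m \<iota>"
    and \<gamma>: "\<gamma> > 0"
    and \<kappa>: "\<kappa> \<ge> 0"
    and approx: "\<exists>C. \<forall>f. q f \<le> 1 \<longrightarrow> (\<forall>N\<ge>1. \<exists>P\<in>polys k. \<exists>a \<omega> b.
        (\<forall>r\<in>{1..N}. norm (\<omega> r) = 1 \<and> b r \<in> {b\<^sub>m..b\<^sub>p}) \<and>
        sobolev_norm \<Omega> m (\<lambda>x. \<iota> f x - (P x + ridge_sum k N a \<omega> b x))
          \<le> C * real N powr (-\<gamma>) * (1 + ln (2 + real N)) powr \<kappa> \<and>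
        (\<Sum>r=1..N. \<bar>a r\<bar>) \<le> M\<^sub>0)"
  shows "\<exists>M\<ge>0. \<exists>C. \<forall>n\<ge>1.
    approx_error \<Omega> k b\<^sub>m b\<^sub>p n m (\<iota> ` {f. q f \<le> 1}) (ennreal M)
      \<le> ennreal (C * real n powr (-\<gamma>) * (1 + ln (2 + real n)) powr \<kappa>)"
proof -
  have \<Omega>: "open \<Omega>" "bounded \<Omega>" "\<Omega> \<noteq> {}"
    using dom by (auto simp: bounded_lipschitz_domain_def)
  have meas: "\<Omega> \<in> sets lebesgue"
    using \<Omega>(1) by (simp add: borel_open)
  obtain R where R: "\<And>x. x \<in> \<Omega> \<Longrightarrow> norm x \<le> R"
    using \<Omega>(2) by (auto simp: bounded_iff)
  let ?ip = "\<lambda>(x :: real^'n, \<omega>). \<omega> \<bullet> x"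
  have ip: "\<bar>\<omega> \<bullet> x\<bar> \<le> R" if "x \<in> \<Omega>" "norm \<omega> = 1" for x \<omega>
    using Cauchy_Schwarz_ineq2[of \<omega> x] R[OF that(1)] that(2) by simp
  have bdd: "bdd_below (?ip ` (\<Omega> \<times> sphere 0 1))" "bdd_above (?ip ` (\<Omega> \<times> sphere 0 1))"
    using ip by (auto intro!: bdd_belowI2[of _ "-R"] bdd_aboveI2[of _ _ R] simp: abs_le_iff minus_le_iff)
  \<comment> \<open>The margin 1 in the choice of \<open>b\<^sub>m\<close> leaves the offset
    interval from \<open>b\<^sub>m\<close> to \<open>b\<^sub>m + 1\<close>, on which ridge functions
    are pure powers over \<open>\<Omega>\<close>; \<open>bmp\<close> below places it inside the
    admissible interval.\<close>
  have above: "b\<^sub>m + 1 \<le> \<omega> \<bullet> x" "\<omega> \<bullet> x + 1 \<le> b\<^sub>p" if "x \<in> \<Omega>" "norm \<omega> = 1" for x \<omega>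
  proof -
    have mem: "(x, \<omega>) \<in> \<Omega> \<times> sphere 0 1"
      using that by simp
    show "b\<^sub>m + 1 \<le> \<omega> \<bullet> x"
      using cINF_lower[OF bdd(1) mem] bm by simp
    show "\<omega> \<bullet> x + 1 \<le> b\<^sub>p"
      using cSUP_upper[OF mem bdd(2)] bp by simp
  qed
  have bmp: "b\<^sub>m + 1 \<le> b\<^sub>p"
  proof -
    obtain x where "x \<in> \<Omega>" using \<Omega>(3) by blast
    from above[OF this, of "axis undefined 1"] show ?thesis by simp
  qed
  obtain K A where A: "A \<ge> 0" and poly: "\<forall>P\<in>polys k. \<exists>a \<omega> b.
      (\<forall>r\<in>{1..K}. norm (\<omega> r) = 1 \<and> b r \<in> {b\<^sub>m..b\<^sub>m + 1}) \<and>
      (\<forall>x\<in>\<Omega>. P x = ridge_sum k K a \<omega> b x) \<and>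
      (\<Sum>r=1..K. \<bar>a r\<bar>) \<le> A * sqrt (\<integral>x. (P x)\<^sup>2 \<partial>lebesgue_on \<Omega>)"
    using poly_eq_ridge_sum[OF \<Omega>(1,2), of b\<^sub>m "b\<^sub>m + 1" k] above(1) by auto
  obtain E where E: "\<And>f. sobolev_norm \<Omega> m (\<iota> f) \<le> E * q f"
    and \<iota>: "\<And>f. \<iota> f \<in> sobolev_space \<Omega> m"
    using emb by (auto simp: continuous_embedding_def)
  \<comment> \<open>The embedding constant is not known to be nonnegative, hence the absolute value;
    the same precaution is taken for \<open>C\<close> and \<open>M\<^sub>0\<close>.\<close>
  have E_unit: "sobolev_norm \<Omega> m (\<iota> f) \<le> \<bar>E\<bar>" if "q f \<le> 1" for f
  proof -
    have "0 \<le> q f"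
      using X by (simp add: quasi_banach_def quasi_norm_def)
    then have "E * q f \<le> \<bar>E\<bar> * 1"
      using that by (intro mult_mono) auto
    with E[of f] show ?thesis by linarith
  qed
  obtain C where C: "\<forall>f. q f \<le> 1 \<longrightarrow> (\<forall>N\<ge>1. \<exists>P\<in>polys k. \<exists>a \<omega> b.
        (\<forall>r\<in>{1..N}. norm (\<omega> r) = 1 \<and> b r \<in> {b\<^sub>m..b\<^sub>p}) \<and>
        sobolev_norm \<Omega> m (\<lambda>x. \<iota> f x - (P x + ridge_sum k N a \<omega> b x))
          \<le> C * real N powr (-\<gamma>) * (1 + ln (2 + real N)) powr \<kappa> \<and>
        (\<Sum>r=1..N. \<bar>a r\<bar>) \<le> M\<^sub>0)"
    using approx ..
  obtain S where S: "S \<ge> 0" "\<And>n. n \<ge> 1 \<Longrightarrow> log_rate \<gamma> \<kappa> n \<le> S"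
    using log_rate_bounded[OF \<gamma> \<kappa>] by blast
  \<comment> \<open>\<open>D\<close> bounds the ridge part pointwise on \<open>\<Omega>\<close>.
    \<open>W\<close> bounds the squared L2 norm of the polynomial, seen as full approximant minus
    ridge part. \<open>M\<close> adds the coefficient budget for rewriting the polynomial.\<close>
  define D where "D = \<bar>M\<^sub>0\<bar> * (\<bar>R\<bar> + \<bar>b\<^sub>m\<bar> + \<bar>b\<^sub>p\<bar>) ^ k"
  define W where "W = 4 * (E\<^sup>2 + (\<bar>C\<bar> * S)\<^sup>2) + 2 * (D\<^sup>2 * measure lebesgue \<Omega>)"
  define M where "M = \<bar>M\<^sub>0\<bar> + A * sqrt W"
  have W: "W \<ge> 0"
    by (simp add: W_def)
  have M: "M \<ge> 0"
    using A W by (simp add: M_def)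
  \<comment> \<open>For n \<ge> 2K the given approximant receives n - K ridge functions, and K are
    reserved for its polynomial.\<close>
  have large: "\<exists>g\<in>ridge_class k b\<^sub>m b\<^sub>p n (ennreal M).
      sobolev_norm \<Omega> m (\<lambda>x. \<iota> f x - g x) \<le> \<bar>C\<bar> * 2 powr \<gamma> * log_rate \<gamma> \<kappa> n"
    if f: "q f \<le> 1" and n: "n \<ge> 1" "2 * K \<le> n" for f n
  proof -
    have N: "n - K \<ge> 1" using n by linarith
    from C f N obtain P a \<omega> b where P: "P \<in> polys k"
      and params: "\<forall>r\<in>{1..n - K}. norm (\<omega> r) = 1 \<and> b r \<in> {b\<^sub>m..b\<^sub>p}"
      and err: "sobolev_norm \<Omega> m (\<lambda>x. \<iota> f x - (P x + ridge_sum k (n - K) a \<omega> b x))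
          \<le> C * real (n - K) powr (-\<gamma>) * (1 + ln (2 + real (n - K))) powr \<kappa>"
      and a: "(\<Sum>r=1..n - K. \<bar>a r\<bar>) \<le> M\<^sub>0"
      by blast
    let ?g = "ridge_sum k (n - K) a \<omega> b" and ?h = "\<lambda>x. P x + ridge_sum k (n - K) a \<omega> b x"
    have g: "continuous_on UNIV ?g" and P_cont: "continuous_on UNIV P"
      using P by (auto intro: continuous_on_ridge_sum continuous_on_polys)
    then have h: "continuous_on UNIV ?h"
      by (intro continuous_intros)
    have err': "sobolev_norm \<Omega> m (\<lambda>x. \<iota> f x - ?h x) \<le> \<bar>C\<bar> * log_rate \<gamma> \<kappa> (n - K)"
      using err mult_right_mono[OF abs_ge_self[of C] log_rate_nonneg[of \<gamma> \<kappa> "n - K"]]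
      by (simp add: log_rate_def mult.assoc)
    have "\<bar>C\<bar> * log_rate \<gamma> \<kappa> (n - K) \<le> \<bar>C\<bar> * S"
      using S(2)[OF N] by (rule mult_left_mono) simp
    with err' have u: "(sobolev_norm \<Omega> m (\<lambda>x. \<iota> f x - ?h x))\<^sup>2 \<le> (\<bar>C\<bar> * S)\<^sup>2"
      using sobolev_norm_nonneg by (intro power_mono) auto
    have e: "(sobolev_norm \<Omega> m (\<iota> f))\<^sup>2 \<le> E\<^sup>2"
      using power_mono[OF E_unit[OF f] sobolev_norm_nonneg, of 2] by simp
    have "\<bar>?g x\<bar> \<le> D" if "x \<in> \<Omega>" for x
    proof -
      have "\<bar>?g x\<bar> \<le> (\<Sum>r=1..n - K. \<bar>a r\<bar>) * (\<bar>R\<bar> + \<bar>b\<^sub>m\<bar> + \<bar>b\<^sub>p\<bar>) ^ k"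
        using R[OF that] params by (intro ridge_sum_bound) auto
      also have "\<dots> \<le> D"
        unfolding D_def using a by (intro mult_right_mono) auto
      finally show ?thesis .
    qed
    then have g2: "(\<integral>x. (?g x)\<^sup>2 \<partial>lebesgue_on \<Omega>) \<le> D\<^sup>2 * measure lebesgue \<Omega>"
      by (rule L2_bounded_le[OF \<Omega>(1,2) g])
    have h2: "(\<integral>x. (?h x)\<^sup>2 \<partial>lebesgue_on \<Omega>) \<le> 2 * (E\<^sup>2 + (\<bar>C\<bar> * S)\<^sup>2)"
      by (rule order_trans[OF L2_le_sobolev_norms[OF \<Omega>(1,2) h \<iota>[of f]] mult_left_mono[OF add_mono[OF e u]]]) simp
    have sq: "integrable (lebesgue_on \<Omega>) (\<lambda>x. (h x)\<^sup>2)" if "continuous_on UNIV h" for h :: "real^'n \<Rightarrow> real"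
      using L2_space_continuous[OF that \<Omega>(1,2)] by (simp add: L2_space_def)
    have "(\<integral>x. (P x)\<^sup>2 \<partial>lebesgue_on \<Omega>) \<le> (\<integral>x. 2 * (?h x)\<^sup>2 + 2 * (?g x)\<^sup>2 \<partial>lebesgue_on \<Omega>)"
    proof (rule integral_mono)
      show "(P x)\<^sup>2 \<le> 2 * (?h x)\<^sup>2 + 2 * (?g x)\<^sup>2" for x
        using zero_le_power2[of "P x + 2 * ?g x"] by (simp add: power2_eq_square algebra_simps)
    qed (use sq[OF P_cont] sq[OF h] sq[OF g] in simp_all)
    also have "\<dots> = 2 * (\<integral>x. (?h x)\<^sup>2 \<partial>lebesgue_on \<Omega>) + 2 * (\<integral>x. (?g x)\<^sup>2 \<partial>lebesgue_on \<Omega>)"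
      using sq[OF h] sq[OF g] by simp
    also have "\<dots> \<le> W"
      using add_mono[OF mult_left_mono[OF h2, of 2] mult_left_mono[OF g2, of 2]] by (simp add: W_def)
    finally have PW: "A * sqrt (\<integral>x. (P x)\<^sup>2 \<partial>lebesgue_on \<Omega>) \<le> A * sqrt W"
      using A by (intro mult_left_mono) simp_all
    from poly P obtain a' \<omega>' b' where params': "\<forall>r\<in>{1..K}. norm (\<omega>' r) = 1 \<and> b' r \<in> {b\<^sub>m..b\<^sub>m + 1}"
      and P_eq: "\<forall>x\<in>\<Omega>. P x = ridge_sum k K a' \<omega>' b' x"
      and a': "(\<Sum>r=1..K. \<bar>a' r\<bar>) \<le> A * sqrt (\<integral>x. (P x)\<^sup>2 \<partial>lebesgue_on \<Omega>)"
      by blast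
    let ?G = "\<lambda>x. ridge_sum k (n - K) a \<omega> b x + ridge_sum k K a' \<omega>' b' x"
    have "?G \<in> ridge_class k b\<^sub>m b\<^sub>p n (ennreal M)"
    proof (rule ridge_sum_add_in_ridge_class)
      show "(\<Sum>r=1..n - K. \<bar>a r\<bar>) + (\<Sum>r=1..K. \<bar>a' r\<bar>) \<le> M"
        unfolding M_def using a a' PW by linarith
      show "n - K + K \<le> n" using n by simp
    qed (use params params' bmp in force)+
    moreover have "sobolev_norm \<Omega> m (\<lambda>x. \<iota> f x - ?G x) \<le> \<bar>C\<bar> * 2 powr \<gamma> * log_rate \<gamma> \<kappa> n"
    proof -
      \<comment> \<open>The rewritten polynomial agrees with \<open>P\<close> only on
        \<open>\<Omega>\<close>, which suffices for the error to be literally the same.\<close>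
      have "sobolev_norm \<Omega> m (\<lambda>x. \<iota> f x - ?G x) = sobolev_norm \<Omega> m (\<lambda>x. \<iota> f x - ?h x)"
        using P_eq by (intro sobolev_norm_cong[OF meas]) simp
      also note err'
      also have "\<bar>C\<bar> * log_rate \<gamma> \<kappa> (n - K) \<le> \<bar>C\<bar> * (2 powr \<gamma> * log_rate \<gamma> \<kappa> n)"
        using log_rate_shift[OF \<gamma> \<kappa> n] by (rule mult_left_mono) simp
      finally show ?thesis by (simp add: mult.assoc)
    qed
    ultimately show ?thesis
      by (intro bexI[of _ ?G])
  qed
  \<comment> \<open>For n \<le> 2K the zero function is the approximant, and its error is controlled
    by the embedding constant.\<close>
  have small: "\<exists>g\<in>ridge_class k b\<^sub>m b\<^sub>p n (ennreal M).
      sobolev_norm \<Omega> m (\<lambda>x. \<iota> f x - g x) \<le> \<bar>E\<bar> * real (2 * K) powr \<gamma> * log_rate \<gamma> \<kappa> n"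
    if f: "q f \<le> 1" and n: "n \<ge> 1" "n \<le> 2 * K" for f n
  proof -
    have "\<bar>E\<bar> * 1 \<le> \<bar>E\<bar> * (real (2 * K) powr \<gamma> * log_rate \<gamma> \<kappa> n)"
      using log_rate_small[OF \<gamma> \<kappa> n] by (rule mult_left_mono) simp
    with E_unit[OF f] have "sobolev_norm \<Omega> m (\<lambda>x. \<iota> f x - 0) \<le> \<bar>E\<bar> * real (2 * K) powr \<gamma> * log_rate \<gamma> \<kappa> n"
      by (simp add: mult.assoc)
    with zero_in_ridge_class[OF M] show ?thesis
      by (intro bexI[of _ "\<lambda>_. 0"])
  qed
  \<comment> \<open>The sum of the constants for large and small n dominates each of them.\<close>
  define C' where "C' = \<bar>C\<bar> * 2 powr \<gamma> + \<bar>E\<bar> * real (2 * K) powr \<gamma>"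
  have "approx_error \<Omega> k b\<^sub>m b\<^sub>p n m (\<iota> ` {f. q f \<le> 1}) (ennreal M)
      \<le> ennreal (C' * real n powr (-\<gamma>) * (1 + ln (2 + real n)) powr \<kappa>)" if n: "n \<ge> 1" for n
    unfolding approx_error_def
  proof (rule SUP_least)
    fix F assume "F \<in> \<iota> ` {f. q f \<le> 1}"
    then obtain f where f: "q f \<le> 1" and F: "F = \<iota> f" by blast
    have C'_ge: "\<bar>C\<bar> * 2 powr \<gamma> * log_rate \<gamma> \<kappa> n \<le> C' * log_rate \<gamma> \<kappa> n"
      "\<bar>E\<bar> * real (2 * K) powr \<gamma> * log_rate \<gamma> \<kappa> n \<le> C' * log_rate \<gamma> \<kappa> n"
      unfolding C'_def by (intro mult_right_mono log_rate_nonneg; simp)+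
    obtain g where g: "g \<in> ridge_class k b\<^sub>m b\<^sub>p n (ennreal M)"
      and le: "sobolev_norm \<Omega> m (\<lambda>x. F x - g x) \<le> C' * log_rate \<gamma> \<kappa> n"
    proof (cases "2 * K \<le> n")
      case True
      from large[OF f n this] that show ?thesis
        unfolding F using C'_ge(1) order_trans by blast
    next
      case False
      then have "n \<le> 2 * K" by simp
      from small[OF f n this] that show ?thesis
        unfolding F using C'_ge(2) order_trans by blast
    qed
    from g have "(INF g\<in>ridge_class k b\<^sub>m b\<^sub>p n (ennreal M). ennreal (sobolev_norm \<Omega> m (\<lambda>x. F x - g x)))
        \<le> ennreal (sobolev_norm \<Omega> m (\<lambda>x. F x - g x))"
      by (rule INF_lower)
    also have "\<dots> \<le> ennreal (C' * log_rate \<gamma> \<kappa> n)"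
      using le by (rule ennreal_leI)
    finally show "(INF g\<in>ridge_class k b\<^sub>m b\<^sub>p n (ennreal M). ennreal (sobolev_norm \<Omega> m (\<lambda>x. F x - g x)))
        \<le> ennreal (C' * real n powr (-\<gamma>) * (1 + ln (2 + real n)) powr \<kappa>)"
      by (simp add: log_rate_def mult.assoc)
  qed
  with M show ?thesis by blast
qed

end
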